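(* Let $N\ge 3$ be odd, and equip $\mathrm{SU}(N)$ with Zeitlin's left-invariant metric $\langle\cdot,\cdot\rangle^L$ determined by an operator $L$ on $\mathfrak{su}(N)$ with $LX_k=\lambda_kX_k$, $LY_k=\lambda_kY_k$. For all $E_k\in\{X_k,Y_k\}$ and $E_l\in\{X_l,Y_l\}$ with $k,l\in Z_N^+$, $$\mathrm{Ric}_N(E_k,E_l)=\begin{cases}\displaystyle\sum_{i\in Z_N^+}\frac{\left(\frac{N}{\pi}\sin\left(\frac{\pi}{N}k\times i\right)\right)^2}{N^2-1}\cdot\frac{-3(\lambda_{k+i}+\lambda_{k-i})+(\lambda_i-\lambda_k)^2(\lambda_{k+i}^{-1}+\lambda_{k-i}^{-1})+4(\lambda_k+\lambda_i)}{8\lambda_i}&\text{if }E_k=E_l,\\[2mm]0&\text{otherwise.}\end{cases}$$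
   Context: Let $N=2M+1$ be odd, $M\ge1$, $Z_N=\{-M,\dots,M\}^2\setminus\{(0,0)\}$, and $Z_N^+=\{k\in Z_N: k_2>0\}\cup\{k\in Z_N:k_1>0,\ k_2=0\}$ (representatives of $Z_N/\pm$). Write $p\times q=p_1q_2-p_2q_1$ for $p,q\in\mathbb Z^2$. Put $\omega=e^{2\pi i/N}$, $\omega^{1/2}=e^{\pi i/N}$, $U=\mathrm{diag}(1,\omega,\dots,\omega^{N-1})$, and let $V$ be the $N\times N$ cyclic shift matrix with entries $V_{j,j+1}=1$ for $1\le j\le N-1$, $V_{N,1}=1$, and all others $0$. For $k\in\mathbb Z^2$ put $T_k=-\frac{iN}{2\pi}\omega^{k_1k_2/2}U^{k_1}V^{k_2}$, $X_k=\frac12(T_k+T_{-k})$, $Y_k=\frac1{2i}(T_k-T_{-k})$ (here $i=\sqrt{-1}$). The family $\{X_k,Y_k\}_{k\in Z_N^+}$ is a real basis of $\mathfrak{su}(N)$. $L:\mathfrak{su}(N)\to\mathfrak{su}(N)$ is an invertible linear operator, Hermitian with respect to $(u,v)=\mathrm{Tr}(u^\dagger v)$, with negative eigenvalues, and with $LX_k=\lambda_kX_k$, $LY_k=\lambda_kY_k$ for $k\in Z_N$ (so $\lambda_{-k}=\lambda_k$). The index of $\lambda$ is read modulo $N$ in each component (so $\lambda_m$ is defined for $m\not\equiv(0,0)$ mod $N$); any term containing $\lambda_{(0,0)}$ is multiplied by a vanishing sine factor and is interpreted as $0$. Zeitlin's metric is the left-invariant Riemannian metric on $\mathrm{SU}(N)$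 given on $\mathfrak{su}(N)$ by $\langle u,v\rangle^L=-\hbar_N\mathrm{Tr}(u^\dagger Lv)$, $\hbar_N=2^4\pi^4/N^3$. With $\nabla$ its Levi-Civita connection and $R(X,Y)Z=\nabla_X\nabla_YZ-\nabla_Y\nabla_XZ-\nabla_{[X,Y]}Z$, the (normalized) Ricci curvature is defined by $$\mathrm{Ric}_N(E,F)=\frac1{N^2-1}\sum_{i\in Z_N^+}\left(\frac{\langle R(X_i,E)F,X_i\rangle^L}{\langle X_i,X_i\rangle^L}+\frac{\langle R(Y_i,E)F,Y_i\rangle^L}{\langle Y_i,Y_i\rangle^L}\right).$$ *)

theory Defs
  imports "HOL-Analysis.Analysis"
begin

section \<open>The group SU(N) and its Lie algebra\<close>

text \<open>N is the cardinality of the index type. A linear order on the index type gives the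
  enumeration of rows and columns that diagonal and shift matrices need.\<close>

type_synonym 'n cmat = "complex ^ 'n ^ 'n"

definition dagger :: "'n::finite cmat \<Rightarrow> 'n cmat" where
  "dagger A = map_matrix cnj (transpose A)"

definition SU :: "'n::finite cmat set" where
  "SU = {g. dagger g ** g = mat 1 \<and> det g = 1}"

definition su :: "'n::finite cmat set" where
  "su = {A. dagger A = - A \<and> trace A = 0}"

definition commutator :: "'n::finite cmat \<Rightarrow> 'n cmat \<Rightarrow> 'n cmat" where
  "commutator A B = A ** B - B ** A"

definition tangent_SU :: "'n::finite cmat \<Rightarrow> 'n cmat set" where
  "tangent_SU g = (\<lambda>A. g ** A) ` su"

section \<open>Smooth functions and vector fields on SU(N)\<close>

primrec C_k_on :: "nat \<Rightarrow> 'a::real_normed_vector set \<Rightarrow> ('a \<Rightarrow> 'b::real_normed_vector) \<Rightarrow> bool" where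
  "C_k_on 0 U f \<longleftrightarrow> continuous_on U f"
| "C_k_on (Suc k) U f \<longleftrightarrow> (\<forall>x\<in>U. f differentiable (at x)) \<and>
     (\<forall>v. C_k_on k U (\<lambda>x. frechet_derivative f (at x) v))"

text \<open>SU(N) is embedded in the space of all matrices, so a function on it is smooth iff it is the
  restriction of a smooth function on an open neighbourhood. Functions and vector fields are total
  in HOL; below, only their values on SU(N) matter.\<close>

definition smooth_SU :: "('n::finite cmat \<Rightarrow> 'b::real_normed_vector) \<Rightarrow> bool" where
  "smooth_SU f \<longleftrightarrow> (\<exists>U F. open U \<and> SU \<subseteq> U \<and> (\<forall>k. C_k_on k U F) \<and> (\<forall>g\<in>SU. F g = f g))"

type_synonym 'n vfield = "'n cmat \<Rightarrow> 'n cmat"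

definition smooth_vfield :: "'n::finite vfield \<Rightarrow> bool" where
  "smooth_vfield X \<longleftrightarrow> smooth_SU X \<and> (\<forall>g\<in>SU. X g \<in> tangent_SU g)"

text \<open>A derivative of f within SU(N) is not unique as a linear map on the ambient space, but any two
  agree on the tangent space. This is therefore meaningful for tangent v, which is how it is used.\<close>

definition dir_deriv :: "('n::finite cmat \<Rightarrow> 'b::real_normed_vector) \<Rightarrow> 'n cmat \<Rightarrow> 'n cmat \<Rightarrow> 'b" where
  "dir_deriv f g v = frechet_derivative f (at g within SU) v"

definition lie_bracket :: "'n::finite vfield \<Rightarrow> 'n vfield \<Rightarrow> 'n vfield" where
  "lie_bracket X Y = (\<lambda>g. dir_deriv Y g (X g) - dir_deriv X g (Y g))"

definition left_inv :: "'n::finite cmat \<Rightarrow> 'n vfield" where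
  "left_inv A = (\<lambda>g. g ** A)"

section \<open>Levi-Civita connection and curvature\<close>

text \<open>The metric m takes a base point and two tangent vectors at that point.\<close>

definition affine_connection :: "('n::finite vfield \<Rightarrow> 'n vfield \<Rightarrow> 'n vfield) \<Rightarrow> bool" where
  "affine_connection nab \<longleftrightarrow>
     (\<forall>X Y. smooth_vfield X \<longrightarrow> smooth_vfield Y \<longrightarrow> smooth_vfield (nab X Y)) \<and>
     (\<forall>X X' Y. smooth_vfield X \<longrightarrow> smooth_vfield X' \<longrightarrow> smooth_vfield Y \<longrightarrow>
        (\<forall>g\<in>SU. nab (\<lambda>h. X h + X' h) Y g = nab X Y g + nab X' Y g)) \<and>
     (\<forall>(f :: 'n cmat \<Rightarrow> real) X Y. smooth_SU f \<longrightarrow> smooth_vfield X \<longrightarrow> smooth_vfield Y \<longrightarrow>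
        (\<forall>g\<in>SU. nab (\<lambda>h. f h *\<^sub>R X h) Y g = f g *\<^sub>R nab X Y g)) \<and>
     (\<forall>X Y Y'. smooth_vfield X \<longrightarrow> smooth_vfield Y \<longrightarrow> smooth_vfield Y' \<longrightarrow>
        (\<forall>g\<in>SU. nab X (\<lambda>h. Y h + Y' h) g = nab X Y g + nab X Y' g)) \<and>
     (\<forall>(f :: 'n cmat \<Rightarrow> real) X Y. smooth_SU f \<longrightarrow> smooth_vfield X \<longrightarrow> smooth_vfield Y \<longrightarrow>
        (\<forall>g\<in>SU. nab X (\<lambda>h. f h *\<^sub>R Y h) g = dir_deriv f g (X g) *\<^sub>R Y g + f g *\<^sub>R nab X Y g))"

definition levi_civita ::
    "('n::finite cmat \<Rightarrow> 'n cmat \<Rightarrow> 'n cmat \<Rightarrow> real) \<Rightarrow> ('n vfield \<Rightarrow> 'n vfield \<Rightarrow> 'n vfield) \<Rightarrow> bool" where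
  "levi_civita m nab \<longleftrightarrow> affine_connection nab \<and>
     (\<forall>X Y. smooth_vfield X \<longrightarrow> smooth_vfield Y \<longrightarrow>
        (\<forall>g\<in>SU. nab X Y g - nab Y X g = lie_bracket X Y g)) \<and>
     (\<forall>X Y Z. smooth_vfield X \<longrightarrow> smooth_vfield Y \<longrightarrow> smooth_vfield Z \<longrightarrow>
        (\<forall>g\<in>SU. dir_deriv (\<lambda>h. m h (Y h) (Z h)) g (X g) =
                 m g (nab X Y g) (Z g) + m g (Y g) (nab X Z g)))"

definition curvature ::
    "('n::finite vfield \<Rightarrow> 'n vfield \<Rightarrow> 'n vfield) \<Rightarrow> 'n vfield \<Rightarrow> 'n vfield \<Rightarrow> 'n vfield \<Rightarrow> 'n vfield" where
  "curvature nab X Y Z = (\<lambda>g. nab X (nab Y Z) g - nab Y (nab X Z) g - nab (lie_bracket X Y) Z g)"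

text \<open>The curvature is tensorial, so its value at the identity may be computed with left-invariant
  extensions of the arguments.\<close>

definition curvature_su ::
    "('n::finite vfield \<Rightarrow> 'n vfield \<Rightarrow> 'n vfield) \<Rightarrow> 'n cmat \<Rightarrow> 'n cmat \<Rightarrow> 'n cmat \<Rightarrow> 'n cmat" where
  "curvature_su nab A B C = curvature nab (left_inv A) (left_inv B) (left_inv C) (mat 1)"

section \<open>The basis\<close>

definition Z_N :: "nat \<Rightarrow> (int \<times> int) set" where
  "Z_N N = (let M = (int N - 1) div 2 in {-M..M} \<times> {-M..M} - {(0, 0)})"

definition Z_N_plus :: "nat \<Rightarrow> (int \<times> int) set" where
  "Z_N_plus N = {k \<in> Z_N N. snd k > 0} \<union> {k \<in> Z_N N. fst k > 0 \<and> snd k = 0}"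

definition cross2 :: "int \<times> int \<Rightarrow> int \<times> int \<Rightarrow> int" where
  "cross2 p q = fst p * snd q - snd p * fst q"

text \<open>The representative modulo N, for odd N, with both components in -M..M. Reading an index of
  the eigenvalues modulo N means applying red. The class of (0, 0) can occur there, but then the
  sine factor in front is zero, so the value of lam at (0, 0) is irrelevant.\<close>

definition red :: "nat \<Rightarrow> int \<times> int \<Rightarrow> int \<times> int" where
  "red N m = (let M = (int N - 1) div 2 in
     ((fst m + M) mod int N - M, (snd m + M) mod int N - M))"

text \<open>Positions are counted from 0.\<close>

definition pos :: "'n::{finite,linorder} \<Rightarrow> nat" where
  "pos j = card {..<j}"

definition clock :: "'n::{finite,linorder} cmat" where
  "clock = (\<chi> i j. if i = j then exp (2 * pi * \<i> / CARD('n)) ^ pos j else 0)"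

definition shift :: "'n::{finite,linorder} cmat" where
  "shift = (\<chi> i j. if pos j = (pos i + 1) mod CARD('n) then 1 else 0)"

definition mat_powi :: "'n::finite cmat \<Rightarrow> int \<Rightarrow> 'n cmat" where
  "mat_powi A k = (if k \<ge> 0 then ((\<lambda>B. A ** B) ^^ nat k) (mat 1)
                   else ((\<lambda>B. matrix_inv A ** B) ^^ nat (- k)) (mat 1))"

definition T_mat :: "int \<times> int \<Rightarrow> 'n::{finite,linorder} cmat" where
  "T_mat k = mat (- (\<i> * CARD('n) / (2 * pi)) * exp (pi * \<i> / CARD('n)) powi (fst k * snd k)) **
     (mat_powi clock (fst k) ** mat_powi shift (snd k))"

definition X_mat :: "int \<times> int \<Rightarrow> 'n::{finite,linorder} cmat" where
  "X_mat k = mat (1 / 2) ** (T_mat k + T_mat (- k))"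

definition Y_mat :: "int \<times> int \<Rightarrow> 'n::{finite,linorder} cmat" where
  "Y_mat k = mat (1 / (2 * \<i>)) ** (T_mat k - T_mat (- k))"

section \<open>Zeitlin's metric and the Ricci curvature\<close>

text \<open>L is an operator on su(N); its values on other matrices are irrelevant.\<close>

definition zeitlin_operator ::
    "('n::{finite,linorder} cmat \<Rightarrow> 'n cmat) \<Rightarrow> (int \<times> int \<Rightarrow> real) \<Rightarrow> bool" where
  "zeitlin_operator L lam \<longleftrightarrow>
     bij_betw L su su \<and>
     (\<forall>u\<in>su. \<forall>v\<in>su. L (u + v) = L u + L v) \<and>
     (\<forall>c::real. \<forall>u\<in>su. L (c *\<^sub>R u) = c *\<^sub>R L u) \<and>
     (\<forall>u\<in>su. \<forall>v\<in>su. trace (dagger u ** L v) = trace (dagger (L u) ** v)) \<and>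
     (\<forall>c::real. \<forall>v\<in>su. v \<noteq> 0 \<longrightarrow> L v = c *\<^sub>R v \<longrightarrow> c < 0) \<and>
     (\<forall>k \<in> Z_N CARD('n). L (X_mat k) = lam k *\<^sub>R X_mat k \<and> L (Y_mat k) = lam k *\<^sub>R Y_mat k)"

text \<open>The trace is real for u and L v in su(N), so Re only converts the type.\<close>

definition zeitlin_inner :: "('n::finite cmat \<Rightarrow> 'n cmat) \<Rightarrow> 'n cmat \<Rightarrow> 'n cmat \<Rightarrow> real" where
  "zeitlin_inner L u v = - (2 ^ 4 * pi ^ 4 / real CARD('n) ^ 3) * Re (trace (dagger u ** L v))"

text \<open>On SU(N), the inverse of g is its conjugate transpose.\<close>

definition zeitlin_metric ::
    "('n::finite cmat \<Rightarrow> 'n cmat) \<Rightarrow> 'n cmat \<Rightarrow> 'n cmat \<Rightarrow> 'n cmat \<Rightarrow> real" where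
  "zeitlin_metric L g u v = zeitlin_inner L (dagger g ** u) (dagger g ** v)"

definition Ric_N ::
    "('n::{finite,linorder} cmat \<Rightarrow> 'n cmat) \<Rightarrow> ('n vfield \<Rightarrow> 'n vfield \<Rightarrow> 'n vfield) \<Rightarrow>
     'n cmat \<Rightarrow> 'n cmat \<Rightarrow> real" where
  "Ric_N L nab E F = 1 / (real CARD('n) ^ 2 - 1) *
     (\<Sum>i\<in>Z_N_plus CARD('n).
        zeitlin_inner L (curvature_su nab (X_mat i) E F) (X_mat i) / zeitlin_inner L (X_mat i) (X_mat i) +
        zeitlin_inner L (curvature_su nab (Y_mat i) E F) (Y_mat i) / zeitlin_inner L (Y_mat i) (Y_mat i))"

end

theory Submission
  imports Defs
begin

text \<open>
  The Levi-Civita connection of a left-invariant metric preserves left-invariant fields, and by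
  Koszul's formula it is nabla_A B = ([A,B] + L^{-1}([A, L B] - [L A, B])) / 2 on the Lie algebra.
  This expression is complex bilinear once L is replaced by the Fourier multiplier with symbol
  lambda, so it can be evaluated on the matrices T k, where [T k, T l] is a sine times T (k + l) and
  everything is diagonal. The Ricci form is the trace of Z |-> R(Z,E)F, which may be computed in
  the complex basis T i: it vanishes on (T k, T l) unless k + l = 0 mod N, and on (T k, T (-k)) it is an
  explicit sum over Z_N; pairing i with -i gives the stated formula.
\<close>

section \<open>Complex matrices\<close>

text \<open>\<open>dir_deriv\<close> evaluates some derivative within \<open>SU\<close>, and such a
  derivative is not unique on the ambient matrix space. Its value at g ** A is pinned down only by
  exhibiting a curve inside \<open>SU\<close> with that velocity, hence the construction of curves.
  Likewise the axioms of a connection speak about values on \<open>SU\<close> while fields are total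
  functions, so locality has to come before covariant derivatives can be iterated. For k in
  \<open>Z_N\<close>, \<open>T_mat k\<close> is not skew-Hermitian, so nothing is assumed about L
  there. Each real object is therefore first identified on \<open>su\<close> with a complex-linear
  one (\<open>multiplier\<close>, \<open>conn\<close>, \<open>curv\<close>), and only the latter is
  evaluated on \<open>T_mat k\<close>. Sums of indices leave \<open>Z_N\<close>, and
  \<open>T_mat k\<close> depends on k modulo N only up to a sign. Giving the zero class the
  eigenvalue 0, together with inverse 0 = 0, keeps all formulas uniform; where this artificial value
  could differ from \<open>lam\<close>, the sine factor vanishes. Oddness of N makes the window
  -M..M a full set of residues closed under negation.\<close>

lemma dagger_nth [simp]: "dagger A $ i $ j = cnj (A $ j $ i)"
  by (simp add: dagger_def transpose_def)

lemma dagger_mult: "dagger (A ** B) = dagger B ** dagger A"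
  by (simp add: vec_eq_iff matrix_matrix_mult_def mult.commute)

lemma dagger_add: "dagger (A + B) = dagger A + dagger B"
  by (simp add: vec_eq_iff)

lemma dagger_diff: "dagger (A - B) = dagger A - dagger B"
  by (simp add: vec_eq_iff)

lemma dagger_scaleR: "dagger (r *\<^sub>R A) = r *\<^sub>R dagger A"
  by (simp add: vec_eq_iff)

lemma dagger_sum: "dagger (sum f S) = (\<Sum>i\<in>S. dagger (f i))"
  by (simp add: vec_eq_iff)

lemma dagger_dagger [simp]: "dagger (dagger A) = A"
  by (simp add: vec_eq_iff)

lemma dagger_mat_1 [simp]: "dagger (mat 1) = mat 1"
  by (simp add: vec_eq_iff mat_def)

lemma trace_dagger: "trace (dagger A) = cnj (trace A)"
  by (simp add: trace_def)

lemma trace_minus: "trace (- A :: 'n::finite cmat) = - trace A"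
  by (simp add: trace_def sum_negf)

lemma trace_scaleR: "trace (r *\<^sub>R A :: 'n::finite cmat) = of_real r * trace A"
  by (simp add: trace_def sum_distrib_left scaleR_conv_of_real[where 'a = complex])

lemma trace_sum: "trace (sum f S :: 'n::finite cmat) = (\<Sum>i\<in>S. trace (f i))"
  unfolding trace_def by (simp add: sum.swap[of _ S])

lemma det_dagger: "det (dagger A) = cnj (det A)"
proof -
  have "det (map_matrix cnj B) = cnj (det B)" for B :: "'n::finite cmat"
    by (simp add: det_def)
  from this[of "transpose A"] show ?thesis
    by (simp add: dagger_def det_transpose)
qed

text \<open>The trace sums the squared moduli of all entries. This gives unitary matrices a constant
  norm in \<open>unitary_curve\<close> and makes the metric nondegenerate in
  \<open>inner_nondegenerate\<close>.\<close>

lemma Re_trace_dagger_self: "Re (trace (dagger A ** A)) = (norm A)\<^sup>2"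
proof -
  have "(norm A)\<^sup>2 = (\<Sum>i\<in>UNIV. \<Sum>j\<in>UNIV. (norm (A $ i $ j))\<^sup>2)"
    by (simp add: norm_vec_def L2_set_def sum_nonneg)
  also have "\<dots> = (\<Sum>j\<in>UNIV. \<Sum>i\<in>UNIV. (norm (A $ i $ j))\<^sup>2)"
    by (rule sum.swap)
  also have "\<dots> = Re (trace (dagger A ** A))"
    unfolding cmod_power2 by (simp add: trace_def matrix_matrix_mult_def power2_eq_square)
  finally show ?thesis by simp
qed

lemma matrix_add_rdistrib: "(A + B) ** C = A ** C + B ** (C :: 'n::finite cmat)"
  by (simp add: vec_eq_iff matrix_matrix_mult_def sum.distrib distrib_right)

lemma matrix_diff_ldistrib: "A ** (B - C) = A ** B - A ** (C :: 'n::finite cmat)"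
  by (simp add: vec_eq_iff matrix_matrix_mult_def sum_subtractf right_diff_distrib)

lemma matrix_diff_rdistrib: "(A - B) ** C = A ** C - B ** (C :: 'n::finite cmat)"
  by (simp add: vec_eq_iff matrix_matrix_mult_def sum_subtractf left_diff_distrib)

lemma matrix_minus_left: "(- A) ** B = - (A ** (B :: 'n::finite cmat))"
  by (simp add: vec_eq_iff matrix_matrix_mult_def sum_negf)

lemma matrix_minus_right: "A ** (- B) = - (A ** (B :: 'n::finite cmat))"
  by (simp add: vec_eq_iff matrix_matrix_mult_def sum_negf)

lemma matrix_sum_right: "A ** sum f S = (\<Sum>i\<in>S. A ** (f i :: 'n::finite cmat))"
  by (induction S rule: infinite_finite_induct) (auto simp: matrix_add_ldistrib)

lemma matrix_scaleR_left: "(r *\<^sub>R A) ** B = r *\<^sub>R (A ** (B :: 'n::finite cmat))"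
  by (simp add: scalar_matrix_assoc)

lemma matrix_scaleR_right: "A ** (r *\<^sub>R B) = r *\<^sub>R (A ** (B :: 'n::finite cmat))"
  by (simp add: matrix_scalar_ac scalar_matrix_assoc)

lemmas matrix_distribs = matrix_add_ldistrib matrix_add_rdistrib matrix_diff_ldistrib
  matrix_diff_rdistrib matrix_minus_left matrix_minus_right

lemma bounded_bilinear_matrix_mult:
  "bounded_bilinear ((**) :: 'n::finite cmat \<Rightarrow> 'n cmat \<Rightarrow> 'n cmat)"
proof -
  have "bilinear ((**) :: 'n cmat \<Rightarrow> 'n cmat \<Rightarrow> 'n cmat)"
    unfolding bilinear_def
    by (intro conjI allI linearI)
      (simp_all add: matrix_add_ldistrib matrix_add_rdistrib matrix_scaleR_left matrix_scaleR_right)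
  then show ?thesis
    by (simp add: bilinear_conv_bounded_bilinear)
qed

section \<open>The Lie algebra\<close>

lemma su_dagger: "A \<in> su \<Longrightarrow> dagger A = - A"
  by (simp add: su_def)

lemma su_0 [simp]: "0 \<in> su"
  by (simp add: su_def vec_eq_iff trace_def)

lemma su_add: "A \<in> su \<Longrightarrow> B \<in> su \<Longrightarrow> A + B \<in> su"
  by (simp add: su_def dagger_add trace_add)

lemma su_diff: "A \<in> su \<Longrightarrow> B \<in> su \<Longrightarrow> A - B \<in> su"
  by (simp add: su_def dagger_diff trace_sub)

lemma su_scaleR: "A \<in> su \<Longrightarrow> r *\<^sub>R A \<in> su"
  by (simp add: su_def dagger_scaleR trace_scaleR)

lemma su_commutator: "A \<in> su \<Longrightarrow> B \<in> su \<Longrightarrow> commutator A B \<in> su"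
  by (simp add: su_def commutator_def dagger_diff dagger_mult trace_sub matrix_distribs
      trace_mul_sym[of A B])

section \<open>Curves in SU(N)\<close>

lemma SU_dagger: "g \<in> SU \<Longrightarrow> dagger g ** g = mat 1"
  by (simp add: SU_def)

lemma SU_one: "mat 1 \<in> SU"
  by (simp add: SU_def)

lemma SU_mult: "g \<in> SU \<Longrightarrow> h \<in> SU \<Longrightarrow> g ** h \<in> SU"
  by (simp add: SU_def dagger_mult det_mul) (metis matrix_mul_assoc matrix_mul_lid)

text \<open>The real inner product is the real part of the Hermitian form s of A at x; skewness
  turns s into minus its conjugate, so s is purely imaginary.\<close>

lemma inner_skew_eq_0:
  fixes A :: "'n::finite cmat"
  assumes "dagger A = - A"
  shows "x \<bullet> (A *v x) = 0"
proof -
  define s where "s = (\<Sum>i\<in>UNIV. \<Sum>j\<in>UNIV. cnj (x $ i) * (A $ i $ j * x $ j))"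
  have A: "cnj (A $ j $ i) = - A $ i $ j" for i j
    using arg_cong[OF assms, of "\<lambda>M. M $ i $ j"] by simp
  have "cnj s = (\<Sum>i\<in>UNIV. \<Sum>j\<in>UNIV. - (cnj (x $ j) * (A $ j $ i * x $ i)))"
    unfolding s_def by (simp add: A mult.commute mult.left_commute)
  also have "\<dots> = - s"
    unfolding s_def by (subst sum.swap) (simp add: sum_negf)
  finally have "Re (cnj s) = Re (- s)"
    by simp
  then have "Re s = 0"
    by simp
  moreover have "x \<bullet> (A *v x) = Re s"
    unfolding s_def
    by (simp add: inner_vec_def inner_complex_def matrix_vector_mult_def sum_distrib_left
        sum.distrib sum_subtractf algebra_simps)
  ultimately show ?thesis by simp
qed

text \<open>A kernel vector satisfies x = A x, which is orthogonal to x, so x = 0: a skew-Hermitian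
  matrix does not have the eigenvalue 1.\<close>

lemma invertible_one_minus_skew:
  fixes A :: "'n::finite cmat"
  assumes "dagger A = - A"
  shows "\<exists>B. B ** (mat 1 - A) = mat 1 \<and> (mat 1 - A) ** B = mat 1"
proof -
  have "x = 0" if "(mat 1 - A) *v x = 0" for x
  proof -
    have "x = A *v x"
      using that by (simp add: matrix_vector_mult_diff_rdistrib)
    then have "x \<bullet> x = 0"
      using inner_skew_eq_0[OF assms, of x] by simp
    then show ?thesis by simp
  qed
  then obtain B where "B ** (mat 1 - A) = mat 1"
    using matrix_left_invertible_ker[of "mat 1 - A"] by blast
  then show ?thesis
    using matrix_left_right_inverse by blast
qed

text \<open>The Cayley transform (1 + A) (1 - A)^(-1). Its second property is the defining equation
  without an inverse, from which \<open>unitary_curve\<close> reads off the velocity without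
  differentiating matrix inversion.\<close>

lemma cayley:
  fixes A :: "'n::finite cmat"
  assumes "dagger A = - A"
  shows "\<exists>U. dagger U ** U = mat 1 \<and> U - mat 1 = A ** (U + mat 1)"
proof -
  obtain B where B: "B ** (mat 1 - A) = mat 1" "(mat 1 - A) ** B = mat 1"
    using invertible_one_minus_skew[OF assms] by blast
  define U where "U = (mat 1 + A) ** B"
  have AB: "A ** B = B - mat 1" and BA: "B ** A = B - mat 1"
    using B by (simp_all add: matrix_distribs algebra_simps)
  have U: "U = B + B - mat 1"
    by (simp add: U_def matrix_distribs AB)
  have "dagger (B ** (mat 1 - A)) = mat 1"
    using B by simp
  then have "dagger U ** U = dagger B ** ((mat 1 - A) ** U)"
    by (simp add: U_def dagger_mult dagger_diff dagger_add assms matrix_mul_assoc)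
  also have "(mat 1 - A) ** U = (mat 1 - A) ** B + (mat 1 - A) ** B - (mat 1 - A)"
    by (simp only: U matrix_add_ldistrib matrix_diff_ldistrib matrix_mul_rid)
  also have "\<dots> = mat 1 + A"
    by (simp add: B)
  also have "dagger B ** (mat 1 + A) = dagger ((mat 1 - A) ** B)"
    by (simp add: dagger_mult dagger_diff assms)
  also have "\<dots> = mat 1"
    using B by simp
  finally have "dagger U ** U = mat 1" .
  moreover have "U + mat 1 = B + B"
    by (simp add: U)
  then have "A ** (U + mat 1) = A ** B + A ** B"
    by (simp only: matrix_add_ldistrib)
  then have "U - mat 1 = A ** (U + mat 1)"
    by (simp add: U AB)
  ultimately show ?thesis by blast
qed

lemma unitary_curve:
  fixes A :: "'n::finite cmat"
  assumes A: "dagger A = - A"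
  shows "\<exists>U. U 0 = mat 1 \<and> (\<forall>t::real. dagger (U t) ** U t = mat 1) \<and>
    (U has_vector_derivative A) (at 0)"
proof -
  \<comment> \<open>The factor 1/2 compensates for U + 1, which is twice the identity at t =
    0.\<close>
  define H where "H = (1/2) *\<^sub>R A"
  have "dagger (t *\<^sub>R H) = - (t *\<^sub>R H)" for t
    by (simp add: H_def dagger_scaleR A)
  \<comment> \<open>The matrices are chosen separately for each t, so even continuity at 0 must come
    from the equation: U t - 1 is t times a bounded matrix. Continuity then shows that the
    difference quotient H ** (U t + 1) tends to A.\<close>
  from cayley[OF this] obtain U where U: "\<And>t. dagger (U t) ** U t = mat 1"
    "\<And>t. U t - mat 1 = (t *\<^sub>R H) ** (U t + mat 1)"
    by metis
  interpret mm: bounded_bilinear "(**) :: 'n cmat \<Rightarrow> 'n cmat \<Rightarrow> 'n cmat"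
    by (rule bounded_bilinear_matrix_mult)
  have bd: "norm (U t) = sqrt (real CARD('n))" for t
  proof -
    have "(norm (U t))\<^sup>2 = real CARD('n)"
      using Re_trace_dagger_self[of "U t"] by (simp add: U trace_I)
    then show ?thesis
      by (metis norm_ge_zero real_sqrt_unique)
  qed
  have eq: "U t = mat 1 + t *\<^sub>R (H ** (U t + mat 1))" for t
    using U(2)[of t] by (simp add: matrix_scaleR_left algebra_simps)
  obtain K where K: "\<And>(a :: 'n cmat) (b :: 'n cmat). norm (a ** b) \<le> norm a * norm b * K"
    using mm.bounded by blast
  define c where "c = norm H * (sqrt (real CARD('n)) + norm (mat 1 :: 'n cmat)) * \<bar>K\<bar>"
  have bd2: "norm (H ** (U t + mat 1)) \<le> c" for t
  proof -
    have "norm (H ** (U t + mat 1)) \<le> norm H * norm (U t + mat 1) * K"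
      by (rule K)
    also have "\<dots> \<le> norm H * norm (U t + mat 1) * \<bar>K\<bar>"
      by (intro mult_left_mono) auto
    also have "\<dots> \<le> c"
      unfolding c_def using norm_triangle_ineq[of "U t" "mat 1"]
      by (intro mult_right_mono mult_left_mono) (auto simp: bd)
    finally show ?thesis .
  qed
  have "((\<lambda>t. U t - mat 1) \<longlongrightarrow> 0) (at 0)"
  proof (rule Lim_null_comparison)
    show "\<forall>\<^sub>F t in at 0. norm (U t - mat 1) \<le> \<bar>t\<bar> * c"
      by (rule always_eventually) (subst eq, simp add: bd2 mult_left_mono)
    show "((\<lambda>t. \<bar>t\<bar> * c) \<longlongrightarrow> 0) (at 0)"
      by (auto intro!: tendsto_eq_intros)
  qed
  then have lim: "(U \<longlongrightarrow> mat 1) (at 0)"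
    by (simp add: LIM_zero_iff)
  have U0: "U 0 = mat 1"
    using eq[of 0] by simp
  have "((\<lambda>t. H ** (U t + mat 1)) \<longlongrightarrow> H ** (mat 1 + mat 1)) (at 0)"
    by (intro mm.tendsto tendsto_intros lim)
  also have "H ** (mat 1 + mat 1) = A"
    by (simp only: matrix_add_ldistrib matrix_mul_rid H_def flip: scaleR_left_distrib) simp
  finally have "((\<lambda>t. H ** (U t + mat 1) - A) \<longlongrightarrow> 0) (at 0)"
    by (simp add: LIM_zero_iff)
  then have *: "((\<lambda>t. norm (H ** (U t + mat 1) - A)) \<longlongrightarrow> 0) (at 0)"
    by (rule tendsto_norm_zero)
  have "((\<lambda>t. norm (U (0 + t) - U 0 - t *\<^sub>R A) / norm t) \<longlongrightarrow> 0) (at 0)"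
  proof (rule Lim_transform_eventually[OF *])
    have "norm (H ** (U t + mat 1) - A) = norm (U (0 + t) - U 0 - t *\<^sub>R A) / norm t"
      if "t \<noteq> 0" for t
    proof -
      have "U t - mat 1 - t *\<^sub>R A = t *\<^sub>R (H ** (U t + mat 1) - A)"
        by (subst eq) (simp add: algebra_simps)
      then show ?thesis
        using that by (simp add: U0)
    qed
    then show "\<forall>\<^sub>F t in at 0. norm (H ** (U t + mat 1) - A) =
        norm (U (0 + t) - U 0 - t *\<^sub>R A) / norm t"
      by (simp add: eventually_at_filter)
  qed
  then have "(U has_vector_derivative A) (at 0)"
    unfolding has_vector_derivative_def has_derivative_at
    by (auto intro: bounded_linear_intros)
  with U U0 show ?thesis by blast
qed

lemma has_vector_derivative_matrix_nth:
  fixes f :: "real \<Rightarrow> 'n::finite cmat"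
  assumes "(f has_vector_derivative D) F"
  shows "((\<lambda>t. f t $ i $ j) has_vector_derivative D $ i $ j) F"
proof -
  have "bounded_linear (\<lambda>M :: 'n cmat. M $ i $ j)"
    by (rule bounded_linear_compose[OF bounded_linear_vec_nth bounded_linear_vec_nth])
  from bounded_linear.has_vector_derivative[OF this assms] show ?thesis .
qed

text \<open>A permutation fixing all points but one is the identity, so only the diagonal contributes.\<close>

lemma det_has_vector_derivative_at_one:
  fixes f :: "real \<Rightarrow> 'n::finite cmat"
  assumes f: "(f has_vector_derivative D) (at 0)" and f0: "f 0 = mat 1"
  shows "((\<lambda>t. det (f t)) has_vector_derivative trace D) (at 0)"
proof -
  let ?P = "{p. p permutes (UNIV :: 'n set)}"
  define e where "e p i = (\<Prod>j\<in>UNIV - {i}. f 0 $ j $ p j)" for p i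
  have e: "e p i = (if p = id then 1 else 0)" if p: "p permutes UNIV" for p i
  proof (cases "p = id")
    case False
    have "\<exists>j. j \<noteq> i \<and> p j \<noteq> j"
    proof (rule ccontr)
      assume "\<not> ?thesis"
      then have *: "p j = j" if "j \<noteq> i" for j using that by blast
      then have "p i = i"
        using permutes_inj[OF p] by (metis injD)
      have "p x = x" for x
        using * \<open>p i = i\<close> by (cases "x = i") auto
      then have "p = id" by (auto simp: fun_eq_iff)
      with False show False by simp
    qed
    then show ?thesis
      using False by (auto simp: e_def f0 mat_def intro!: prod_zero)
  qed (simp add: e_def f0 mat_def)
  have "((\<lambda>t. \<Prod>i\<in>UNIV. f t $ i $ p i) has_derivative
      (\<lambda>x. \<Sum>i\<in>UNIV. (x *\<^sub>R D $ i $ p i) * e p i)) (at 0)" for p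
    unfolding e_def
    using has_vector_derivative_matrix_nth[OF f, unfolded has_vector_derivative_def]
    by (intro has_derivative_prod) auto
  then have "((\<lambda>t. det (f t)) has_derivative
      (\<lambda>x. \<Sum>p\<in>?P. of_int (sign p) * (\<Sum>i\<in>UNIV. (x *\<^sub>R D $ i $ p i) * e p i))) (at 0)"
    unfolding det_def by (intro has_derivative_sum has_derivative_mult_right) simp
  also have "(\<lambda>x. \<Sum>p\<in>?P. of_int (sign p) * (\<Sum>i\<in>UNIV. (x *\<^sub>R D $ i $ p i) * e p i)) =
      (\<lambda>x. \<Sum>p\<in>?P. if p = id then x *\<^sub>R trace D else 0)"
    by (intro ext sum.cong refl) (auto simp: e trace_def sign_id scaleR_sum_right)
  also have "\<dots> = (\<lambda>x. x *\<^sub>R trace D)"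
    by (simp add: finite_permutations permutes_id)
  finally show ?thesis
    unfolding has_vector_derivative_def .
qed

text \<open>Correcting one diagonal entry by the conjugate of the determinant moves a unitary curve into
  SU(N); this does not change the velocity, because the determinant is stationary at trace 0.\<close>

lemma SU_curve:
  fixes A :: "'n::finite cmat"
  assumes A: "A \<in> su" and g: "g \<in> SU"
  shows "\<exists>c. c 0 = g \<and> (\<forall>t::real. c t \<in> SU) \<and> (c has_vector_derivative g ** A) (at 0)"
proof -
  obtain U where U0: "U 0 = mat 1" and U: "\<And>t. dagger (U t) ** U t = mat 1"
    and dU: "(U has_vector_derivative A) (at 0)"
    using unitary_curve[OF su_dagger[OF A]] by blast
  interpret mm: bounded_bilinear "(**) :: 'n cmat \<Rightarrow> 'n cmat \<Rightarrow> 'n cmat"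
    by (rule bounded_bilinear_matrix_mult)
  fix i0 :: 'n
  define E where "E = (\<lambda>z. \<chi> i j. if i = i0 \<and> j = i0 then z else (0 :: complex))"
  define d where "d t = cnj (det (U t))" for t
  define P where "P t = mat 1 + E (d t - 1)" for t
  have "bounded_linear E"
    unfolding linear_conv_bounded_linear[symmetric]
    by (intro linearI) (auto simp: E_def vec_eq_iff)
  moreover have "((\<lambda>t. d t - 1) has_vector_derivative 0) (at 0)"
  proof -
    have "(d has_vector_derivative cnj (trace A)) (at 0)"
      unfolding d_def using det_has_vector_derivative_at_one[OF dU U0]
      by (rule bounded_linear.has_vector_derivative[OF bounded_linear_cnj])
    then have "(d has_vector_derivative 0) (at 0)"
      using A by (simp add: su_def)
    then show ?thesis
      by (auto intro: derivative_eq_intros)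
  qed
  ultimately have "((\<lambda>t. E (d t - 1)) has_vector_derivative E 0) (at 0)"
    by (rule bounded_linear.has_vector_derivative)
  moreover have "E 0 = 0"
    by (simp add: E_def vec_eq_iff)
  ultimately have dP: "(P has_vector_derivative 0) (at 0)"
    unfolding P_def by (auto intro: derivative_eq_intros)
  have P0: "P 0 = mat 1"
    using \<open>E 0 = 0\<close> by (simp add: P_def d_def U0)
  have d1: "d t * cnj (d t) = 1" for t
    using arg_cong[OF U[of t], of det] by (simp add: det_mul det_dagger d_def)
  have PP: "dagger (P t) ** P t = mat 1" for t
  proof -
    have "(dagger (P t) ** P t) $ i $ j = mat 1 $ i $ j" for i j
    proof -
      have "cnj (P t $ l $ i) * P t $ l $ j =
          (if l = i then (if i = j then 1 else 0) else 0)" for l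
        using d1[of t] by (auto simp: P_def E_def mat_def mult.commute)
      then show ?thesis
        by (simp add: matrix_matrix_mult_def mat_def)
    qed
    then show ?thesis by (simp add: vec_eq_iff)
  qed
  have detP: "det (P t) = d t" for t
  proof -
    have "det (P t) = (\<Prod>i\<in>UNIV. P t $ i $ i)"
      by (rule det_diagonal) (auto simp: P_def E_def mat_def)
    also have "\<dots> = (\<Prod>i\<in>UNIV. if i = i0 then d t else 1)"
      by (intro prod.cong) (auto simp: P_def E_def mat_def)
    finally show ?thesis by simp
  qed
  have "U t ** P t \<in> SU" for t
  proof -
    have "dagger (U t ** P t) ** (U t ** P t) = dagger (P t) ** ((dagger (U t) ** U t) ** P t)"
      by (simp only: dagger_mult matrix_mul_assoc)
    then show ?thesis
      using d1[of t] by (simp add: SU_def U PP det_mul detP) (simp add: d_def mult.commute)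
  qed
  then have "\<forall>t. g ** (U t ** P t) \<in> SU"
    using g SU_mult by blast
  moreover have "((\<lambda>t. U t ** P t) has_vector_derivative U 0 ** 0 + A ** P 0) (at 0)"
    by (intro mm.has_vector_derivative dU dP)
  then have "((\<lambda>t. U t ** P t) has_vector_derivative A) (at 0)"
    by (simp add: P0 mm.zero_right)
  then have "((\<lambda>t. g ** (U t ** P t)) has_vector_derivative g ** A) (at 0)"
    by (rule bounded_linear.has_vector_derivative[OF mm.bounded_linear_right])
  moreover have "g ** (U 0 ** P 0) = g"
    by (simp add: U0 P0)
  ultimately show ?thesis
    by (intro exI[of _ "\<lambda>t. g ** (U t ** P t)"]) simp
qed

text \<open>Composed with a curve in \<open>SU\<close> of velocity g ** A, any two derivatives of f
  within \<open>SU\<close> give the velocity of the same curve t |-> f (c t), and that velocity is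
  unique.\<close>

lemma dir_deriv_eqI:
  assumes f: "(f has_derivative D) (at g within SU)" and g: "g \<in> SU" and A: "A \<in> su"
  shows "dir_deriv f g (g ** A) = D (g ** A)"
proof -
  obtain c where c0: "c 0 = g" and c: "\<And>t::real. c t \<in> SU"
    and dc: "(c has_vector_derivative g ** A) (at 0)"
    using SU_curve[OF A g] by blast
  have *: "((\<lambda>t. f (c t)) has_vector_derivative D' (g ** A)) (at 0)"
    if D': "(f has_derivative D') (at g within SU)" for D'
  proof -
    have "((\<lambda>t. f (c t)) has_derivative (\<lambda>t. D' (t *\<^sub>R (g ** A)))) (at 0)"
    proof (rule has_derivative_in_compose[OF dc[unfolded has_vector_derivative_def]])
      show "(f has_derivative D') (at (c 0) within range c)"
        unfolding c0 using c by (intro has_derivative_subset[OF D']) auto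
    qed
    then show ?thesis
      using linear_cmul[OF has_derivative_linear[OF D']] by (simp add: has_vector_derivative_def)
  qed
  have "(f has_derivative frechet_derivative f (at g within SU)) (at g within SU)"
    using f frechet_derivative_works differentiable_def by blast
  from *[OF this] *[OF f] show ?thesis
    unfolding dir_deriv_def by (rule vector_derivative_unique_at)
qed

lemma dir_deriv_const:
  assumes "\<And>h. h \<in> SU \<Longrightarrow> f h = r" and g: "g \<in> SU" and A: "A \<in> su"
  shows "dir_deriv f g (g ** A) = 0"
proof (rule dir_deriv_eqI[OF _ g A])
  show "(f has_derivative (\<lambda>_. 0)) (at g within SU)"
    by (rule has_derivative_transform[OF g assms(1) has_derivative_const])
qed

section \<open>Left-invariant fields\<close>

lemma left_inv_apply: "left_inv A g = g ** A"
  by (simp add: left_inv_def)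

lemma C_k_on_const: "C_k_on k UNIV (\<lambda>_. r)"
  by (induction k arbitrary: r) (auto simp: frechet_derivative_const)

lemma smooth_SU_eq:
  assumes "smooth_SU f" "\<And>g. g \<in> SU \<Longrightarrow> f' g = f g"
  shows "smooth_SU f'"
  using assms unfolding smooth_SU_def by metis

lemma smooth_SU_const: "smooth_SU (\<lambda>_. r)"
  unfolding smooth_SU_def using C_k_on_const by (intro exI[of _ UNIV] exI[of _ "\<lambda>_. r"]) auto

lemma bounded_linear_left_inv: "bounded_linear (left_inv A)"
  unfolding left_inv_def
  by (rule bounded_bilinear.bounded_linear_left[OF bounded_bilinear_matrix_mult])

lemma smooth_SU_left_inv: "smooth_SU (left_inv A)"
proof -
  have der: "(left_inv A has_derivative left_inv A) (at x)" for x
    by (rule bounded_linear_imp_has_derivative[OF bounded_linear_left_inv])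
  have "C_k_on k UNIV (left_inv A)" for k
  proof (cases k)
    case 0
    then show ?thesis
      using linear_continuous_on[OF bounded_linear_left_inv] by simp
  next
    case (Suc m)
    then show ?thesis
      using der C_k_on_const by (auto simp: differentiable_def simp flip: frechet_derivative_at[OF der])
  qed
  then show ?thesis
    unfolding smooth_SU_def by (intro exI[of _ UNIV] exI[of _ "left_inv A"]) auto
qed

lemma smooth_vfield_left_inv: "A \<in> su \<Longrightarrow> smooth_vfield (left_inv A)"
  by (auto simp: smooth_vfield_def smooth_SU_left_inv tangent_SU_def left_inv_apply)

lemma smooth_vfield_eq:
  assumes "smooth_vfield X" "\<And>g. g \<in> SU \<Longrightarrow> X' g = X g"
  shows "smooth_vfield X'"
  using assms smooth_SU_eq[of X X'] by (simp add: smooth_vfield_def)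

text \<open>Left-invariant fields are restrictions of linear maps, so the derivative of
  \<open>left_inv B\<close> along g ** A is g ** A ** B; the order in \<open>lie_bracket\<close>
  then yields the commutator with a plus sign.\<close>

lemma lie_bracket_left_inv:
  assumes "A \<in> su" "B \<in> su" "g \<in> SU"
  shows "lie_bracket (left_inv A) (left_inv B) g = left_inv (commutator A B) g"
proof -
  have "dir_deriv (left_inv C) g (g ** D) = left_inv C (g ** D)" if "D \<in> su" for C D
    using that \<open>g \<in> SU\<close>
    by (intro dir_deriv_eqI bounded_linear_imp_has_derivative bounded_linear_left_inv)
  then show ?thesis
    using assms
    by (simp add: lie_bracket_def left_inv_apply commutator_def matrix_distribs matrix_mul_assoc)
qed

section \<open>Locality of connections\<close>

context
  fixes nab :: "'n::finite vfield \<Rightarrow> 'n vfield \<Rightarrow> 'n vfield"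
  assumes nab: "affine_connection nab"
begin

lemma nab_add_left:
  assumes "smooth_vfield X" "smooth_vfield X'" "smooth_vfield Y" "g \<in> SU"
  shows "nab (\<lambda>h. X h + X' h) Y g = nab X Y g + nab X' Y g"
  using nab[unfolded affine_connection_def, THEN conjunct2, THEN conjunct1, rule_format] assms
  by blast

lemma nab_scale_left:
  assumes "smooth_SU f" "smooth_vfield X" "smooth_vfield Y" "g \<in> SU"
  shows "nab (\<lambda>h. f h *\<^sub>R X h) Y g = f g *\<^sub>R nab X Y g"
  using nab[unfolded affine_connection_def, THEN conjunct2, THEN conjunct2, THEN conjunct1,
      rule_format] assms
  by blast

lemma nab_add_right:
  assumes "smooth_vfield X" "smooth_vfield Y" "smooth_vfield Y'" "g \<in> SU"
  shows "nab X (\<lambda>h. Y h + Y' h) g = nab X Y g + nab X Y' g"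
  using nab[unfolded affine_connection_def, THEN conjunct2, THEN conjunct2, THEN conjunct2,
      THEN conjunct1, rule_format] assms
  by blast

lemma nab_scale_right:
  assumes "smooth_SU f" "smooth_vfield X" "smooth_vfield Y" "g \<in> SU"
  shows "nab X (\<lambda>h. f h *\<^sub>R Y h) g = dir_deriv f g (X g) *\<^sub>R Y g + f g *\<^sub>R nab X Y g"
  using nab[unfolded affine_connection_def, THEN conjunct2, THEN conjunct2, THEN conjunct2,
      THEN conjunct2, rule_format] assms
  by blast

lemma smooth_SU_indicator: "smooth_SU (\<lambda>h :: 'n cmat. if h \<in> SU then 0 else 1 :: real)"
  by (rule smooth_SU_eq[OF smooth_SU_const[of 0]]) simp

lemma smooth_vfield_zero:
  assumes "\<And>g. g \<in> SU \<Longrightarrow> D g = 0"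
  shows "smooth_vfield D"
  by (rule smooth_vfield_eq[OF smooth_vfield_left_inv[of 0]])
    (simp_all add: assms left_inv_apply matrix_matrix_mult_def vec_eq_iff)

text \<open>A field D vanishing on SU(N) equals f D, where f is the indicator of the complement; as f is
  smooth on SU(N), the Leibniz rule applies to f D.\<close>

lemma nab_zero_right:
  assumes X: "smooth_vfield X" and D: "\<And>g. g \<in> SU \<Longrightarrow> D g = 0" and g: "g \<in> SU"
  shows "nab X D g = 0"
proof -
  define f :: "'n cmat \<Rightarrow> real" where "f h = (if h \<in> SU then 0 else 1)" for h
  have "nab X (\<lambda>h. f h *\<^sub>R D h) g = dir_deriv f g (X g) *\<^sub>R D g + f g *\<^sub>R nab X D g"
    by (rule nab_scale_right[OF _ X smooth_vfield_zero[OF D] g])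
      (simp_all add: smooth_SU_indicator f_def[abs_def])
  moreover have "(\<lambda>h. f h *\<^sub>R D h) = D"
    using D by (auto simp: f_def)
  ultimately show ?thesis
    using D g by (simp add: f_def)
qed

lemma nab_zero_left:
  assumes X: "smooth_vfield X" and D: "\<And>g. g \<in> SU \<Longrightarrow> D g = 0" and g: "g \<in> SU"
  shows "nab D X g = 0"
proof -
  define f :: "'n cmat \<Rightarrow> real" where "f h = (if h \<in> SU then 0 else 1)" for h
  have "nab (\<lambda>h. f h *\<^sub>R D h) X g = f g *\<^sub>R nab D X g"
    by (rule nab_scale_left[OF _ smooth_vfield_zero[OF D] X g])
      (simp_all add: smooth_SU_indicator f_def[abs_def])
  moreover have "(\<lambda>h. f h *\<^sub>R D h) = D"
    using D by (auto simp: f_def)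
  ultimately show ?thesis
    using g by (simp add: f_def)
qed

text \<open>Y' is Y plus a field vanishing on \<open>SU\<close>, which contributes nothing. This
  permits replacing a covariant derivative by the left-invariant field it equals on
  \<open>SU\<close> only.\<close>

lemma nab_cong_right:
  assumes X: "smooth_vfield X" and Y: "smooth_vfield Y"
    and eq: "\<And>g. g \<in> SU \<Longrightarrow> Y' g = Y g" and g: "g \<in> SU"
  shows "nab X Y' g = nab X Y g"
proof -
  have "smooth_vfield (\<lambda>h. Y' h - Y h)"
    by (rule smooth_vfield_zero) (simp add: eq)
  then have "nab X (\<lambda>h. Y h + (Y' h - Y h)) g = nab X Y g + nab X (\<lambda>h. Y' h - Y h) g"
    by (intro nab_add_right X Y g)
  then show ?thesis
    using nab_zero_right[OF X _ g, of "\<lambda>h. Y' h - Y h"] eq by simp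
qed

lemma nab_cong_left:
  assumes X: "smooth_vfield X" and Y: "smooth_vfield Y"
    and eq: "\<And>g. g \<in> SU \<Longrightarrow> Y' g = Y g" and g: "g \<in> SU"
  shows "nab Y' X g = nab Y X g"
proof -
  have "smooth_vfield (\<lambda>h. Y' h - Y h)"
    by (rule smooth_vfield_zero) (simp add: eq)
  then have "nab (\<lambda>h. Y h + (Y' h - Y h)) X g = nab Y X g + nab (\<lambda>h. Y' h - Y h) X g"
    by (intro nab_add_left X Y g)
  then show ?thesis
    using nab_zero_left[OF X _ g, of "\<lambda>h. Y' h - Y h"] eq by simp
qed

text \<open>\<open>K\<close> stands for the connection transported to the Lie algebra. It describes
  the inner fields on \<open>SU\<close> only, so the congruences above must act before
  \<open>K\<close> can be applied a second time.\<close>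

lemma curvature_su_eq:
  assumes K: "\<And>A B g. A \<in> su \<Longrightarrow> B \<in> su \<Longrightarrow> g \<in> SU \<Longrightarrow>
      nab (left_inv A) (left_inv B) g = left_inv (K A B) g"
    and K_su: "\<And>A B. A \<in> su \<Longrightarrow> B \<in> su \<Longrightarrow> K A B \<in> su"
    and A: "A \<in> su" and B: "B \<in> su" and C: "C \<in> su"
  shows "curvature_su nab A B C = K A (K B C) - K B (K A C) - K (commutator A B) C"
proof -
  have 1: "nab (left_inv X) (nab (left_inv Y) (left_inv Z)) (mat 1) = K X (K Y Z)"
    if "X \<in> su" "Y \<in> su" "Z \<in> su" for X Y Z
  proof -
    have "nab (left_inv X) (nab (left_inv Y) (left_inv Z)) (mat 1)
        = nab (left_inv X) (left_inv (K Y Z)) (mat 1)"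
      using that by (intro nab_cong_right smooth_vfield_left_inv K_su SU_one K) auto
    also have "\<dots> = K X (K Y Z)"
      using that by (subst K) (auto simp: K_su SU_one left_inv_apply)
    finally show ?thesis .
  qed
  have "nab (lie_bracket (left_inv A) (left_inv B)) (left_inv C) (mat 1)
      = nab (left_inv (commutator A B)) (left_inv C) (mat 1)"
    using A B C
    by (intro nab_cong_left smooth_vfield_left_inv su_commutator SU_one lie_bracket_left_inv)
  also have "\<dots> = K (commutator A B) C"
    using A B C by (subst K) (auto simp: su_commutator SU_one left_inv_apply)
  finally show ?thesis
    using A B C by (simp add: curvature_su_def curvature_def 1)
qed

end

section \<open>Complex scaling of matrices\<close>

text \<open>Complex scalars are needed because the computation takes place in complex combinations
  of the \<open>T_mat k\<close>, whereas \<open>*\<^sub>R\<close> preserves the real space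
  \<open>su\<close>.\<close>

definition cscale :: "complex \<Rightarrow> 'n::finite cmat \<Rightarrow> 'n cmat" where
  "cscale z A = (\<chi> i j. z * A $ i $ j)"

lemma cscale_nth [simp]: "cscale z A $ i $ j = z * A $ i $ j"
  by (simp add: cscale_def)

lemma mat_mult_eq_cscale: "mat z ** A = cscale z A"
  by (simp add: vec_eq_iff matrix_matrix_mult_def mat_def if_distrib if_distribR sum.delta'
      cong: if_cong)

lemma cscale_cscale [simp]: "cscale a (cscale b A) = cscale (a * b) A"
  by (simp add: vec_eq_iff)

lemma cscale_add: "cscale z (A + B) = cscale z A + cscale z B"
  by (simp add: vec_eq_iff distrib_left)

lemma cscale_diff: "cscale z (A - B) = cscale z A - cscale z B"
  by (simp add: vec_eq_iff right_diff_distrib)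

lemma cscale_add_left: "cscale (a + b) A = cscale a A + cscale b A"
  by (simp add: vec_eq_iff distrib_right)

lemma cscale_diff_left: "cscale (a - b) A = cscale a A - cscale b A"
  by (simp add: vec_eq_iff left_diff_distrib)

lemma cscale_sum: "cscale z (sum f S) = (\<Sum>i\<in>S. cscale z (f i))"
  by (simp add: vec_eq_iff sum_distrib_left)

lemma cscale_of_real: "cscale (of_real r) A = r *\<^sub>R A"
  by (simp add: vec_eq_iff scaleR_conv_of_real[where 'a = complex])

lemma cscale_mult_left: "cscale z A ** B = cscale z (A ** B)"
  by (simp add: vec_eq_iff matrix_matrix_mult_def sum_distrib_left mult.assoc)

lemma cscale_mult_right: "A ** cscale z B = cscale z (A ** B)"
  by (simp add: vec_eq_iff matrix_matrix_mult_def sum_distrib_left mult.left_commute)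

lemma trace_cscale: "trace (cscale z A) = z * trace A"
  by (simp add: trace_def sum_distrib_left)

lemma dagger_cscale: "dagger (cscale z A) = cscale (cnj z) (dagger A)"
  by (simp add: vec_eq_iff)

lemma commutator_cscale:
  "commutator (cscale a A) B = cscale a (commutator A B)"
  "commutator A (cscale a B) = cscale a (commutator A B)"
  by (simp_all add: commutator_def cscale_mult_left cscale_mult_right cscale_diff)

lemma commutator_add:
  "commutator (A + B) C = commutator A C + commutator B C"
  "commutator A (B + C) = commutator A B + commutator A C"
  by (simp_all add: commutator_def matrix_distribs)

text \<open>Clock, shift and all \<open>T_mat k\<close> have at most one nonzero entry per row, so
  every product with one of them on the left collapses to a single term.\<close>

lemma sparse_row_mult:
  fixes A B :: "'n::finite cmat"
  assumes "\<And>m. m \<noteq> s \<Longrightarrow> A $ i $ m = 0"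
  shows "(A ** B) $ i $ j = A $ i $ s * B $ s $ j"
proof -
  have "(\<Sum>m\<in>UNIV. A $ i $ m * B $ m $ j) = (\<Sum>m\<in>{s}. A $ i $ m * B $ m $ j)"
    using assms by (intro sum.mono_neutral_right) auto
  then show ?thesis by (simp add: matrix_matrix_mult_def)
qed

section \<open>Half-integral powers of the root of unity\<close>

text \<open>This is omega^(m/2), with exponents counted in halves so that they remain integers.
  Powers of omega itself are the even arguments, and only for these does the exponent matter modulo
  N; an odd multiple of N gives -1.\<close>

definition half_root :: "nat \<Rightarrow> int \<Rightarrow> complex" where
  "half_root N m = cis (pi * real_of_int m / real N)"

lemma half_root_add: "half_root N (a + b) = half_root N a * half_root N b"
  by (simp add: half_root_def cis_mult add_divide_distrib distrib_left)

lemma half_root_0 [simp]: "half_root N 0 = 1"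
  by (simp add: half_root_def)

lemma cnj_half_root: "cnj (half_root N m) = half_root N (- m)"
  by (simp add: half_root_def cis_cnj)

lemma half_root_mult_nat: "half_root N (a * int n) = half_root N a ^ n"
proof (induction n)
  case (Suc n)
  have "a * int (Suc n) = a + a * int n"
    by (simp add: algebra_simps)
  then show ?case
    by (simp only: half_root_add Suc.IH power_Suc)
qed simp

lemma half_root_eq_1_iff:
  assumes "N > 0"
  shows "half_root N (2 * m) = 1 \<longleftrightarrow> int N dvd m"
proof -
  have "half_root N (2 * m) = 1 \<longleftrightarrow> (\<exists>n::int. pi * real_of_int (2 * m) / real N = of_int (2 * n) * pi)"
    unfolding half_root_def cis_conv_exp exp_eq_1 by simp
  also have "\<dots> \<longleftrightarrow> (\<exists>n::int. real_of_int m = real_of_int (int N * n))"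
    using assms by (intro ex_cong1) (auto simp: field_simps)
  also have "\<dots> \<longleftrightarrow> int N dvd m"
    unfolding of_int_eq_iff dvd_def ..
  finally show ?thesis .
qed

lemma half_root_double_cong:
  assumes "N > 0" "int N dvd a - b"
  shows "half_root N (2 * a) = half_root N (2 * b)"
proof -
  have "half_root N (2 * a) = half_root N (2 * (a - b)) * half_root N (2 * b)"
    by (simp flip: half_root_add)
  then show ?thesis
    using assms half_root_eq_1_iff[of N "a - b"] by simp
qed

text \<open>Orthogonality of characters: a geometric sum over an N-th root of unity.\<close>

lemma sum_half_root:
  assumes "N > 0"
  shows "(\<Sum>n<N. half_root N (2 * m * int n)) = (if int N dvd m then of_nat N else 0)"
proof (cases "int N dvd m")
  case True
  then have "half_root N (2 * m) = 1"
    using half_root_eq_1_iff[OF assms] by simp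
  then show ?thesis
    using True by (simp add: half_root_mult_nat)
next
  case False
  have "half_root N (2 * m) ^ N = half_root N (2 * (m * int N))"
    by (simp flip: half_root_mult_nat add: mult.assoc)
  also have "\<dots> = 1"
    by (subst half_root_eq_1_iff[OF assms]) simp
  finally show ?thesis
    using False half_root_eq_1_iff[OF assms, of m] by (simp add: half_root_mult_nat sum_gp_strict)
qed

section \<open>Positions modulo N\<close>

lemma pos_less: "pos (j :: 'n::{finite,linorder}) < CARD('n)"
  unfolding pos_def by (rule psubset_card_mono) auto

lemma pos_strict_mono: "i < j \<Longrightarrow> pos i < pos (j :: 'n::{finite,linorder})"
  unfolding pos_def by (rule psubset_card_mono) auto

lemma bij_pos: "bij_betw (pos :: 'n::{finite,linorder} \<Rightarrow> nat) UNIV {..<CARD('n)}"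
proof -
  have "inj (pos :: 'n \<Rightarrow> nat)"
    by (metis injI linorder_neqE nat_less_le pos_strict_mono)
  moreover from this have "range (pos :: 'n \<Rightarrow> nat) = {..<CARD('n)}"
    by (intro card_subset_eq) (auto simp: pos_less card_image)
  ultimately show ?thesis
    by (simp add: bij_betw_def)
qed

text \<open>A total inverse of \<open>pos\<close> modulo N: index arithmetic is done in
  \<open>int\<close>, and the cyclic wrap-around is confined to this function.\<close>

definition site :: "int \<Rightarrow> 'n::{finite,linorder}" where
  "site x = inv_into UNIV pos (nat (x mod int CARD('n)))"

lemma pos_site: "int (pos (site x :: 'n::{finite,linorder})) = x mod int CARD('n)"
proof -
  have "nat (x mod int CARD('n)) \<in> range (pos :: 'n \<Rightarrow> nat)"
    using bij_pos[where 'n = 'n] by (simp add: bij_betw_def nat_less_iff)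
  then have "pos (site x :: 'n) = nat (x mod int CARD('n))"
    unfolding site_def by (rule f_inv_into_f)
  then show ?thesis by simp
qed

lemma eq_site_iff: "j = site x \<longleftrightarrow> int (pos (j :: 'n::{finite,linorder})) mod int CARD('n) = x mod int CARD('n)"
proof -
  have "inj (pos :: 'n \<Rightarrow> nat)"
    using bij_pos by (auto simp: bij_betw_def)
  then have "j = site x \<longleftrightarrow> int (pos j) = int (pos (site x :: 'n))"
    by (simp add: inj_eq)
  then show ?thesis
    using pos_less[of j] by (simp add: pos_site)
qed

lemma site_pos_add: "site (int (pos (site x :: 'n::{finite,linorder})) + y) = (site (x + y) :: 'n)"
  by (simp add: eq_site_iff pos_site mod_add_left_eq)

text \<open>Wrapping around changes the position by a multiple of N, which is invisible to integral
  powers of omega.\<close>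

lemma half_root_pos_site:
  "half_root CARD('n) (2 * (a * int (pos (site x :: 'n::{finite,linorder})))) =
   half_root CARD('n) (2 * (a * x))"
proof (rule half_root_double_cong)
  have "a * (x mod int CARD('n)) - a * x = a * - (int CARD('n) * (x div int CARD('n)))"
    by (metis minus_mod_eq_mult_div minus_diff_eq right_diff_distrib)
  then show "int CARD('n) dvd a * int (pos (site x :: 'n)) - a * x"
    by (simp add: pos_site)
qed simp

section \<open>The matrices T\<close>

text \<open>The prefactor of \<open>T_mat\<close>, written as minus the imaginary unit times a real
  number so that its conjugate and its square are immediate.\<close>

definition zcoef :: "nat \<Rightarrow> complex" where
  "zcoef N = - (\<i> * of_real (real N / (2 * pi)))"

lemma zcoef_nonzero: "N > 0 \<Longrightarrow> zcoef N \<noteq> 0"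
  by (simp add: zcoef_def)

lemma cnj_zcoef: "cnj (zcoef N) = - zcoef N"
  by (simp add: zcoef_def)

text \<open>A homomorphism from the integers to matrices supplies the inverse of its generator as G
  (-1), so \<open>matrix_inv\<close> never has to be computed.\<close>

lemma mat_powi_eqI:
  fixes G :: "int \<Rightarrow> 'n::finite cmat"
  assumes G0: "G 0 = mat 1" and Gadd: "\<And>a b. G (a + b) = G a ** G b"
  shows "mat_powi (G 1) k = G k"
proof -
  have pw: "((\<lambda>B. G a ** B) ^^ n) (mat 1) = G (int n * a)" for a n
  proof (induction n)
    case (Suc n)
    have "G (int (Suc n) * a) = G (a + int n * a)" by (simp add: algebra_simps)
    then show ?case by (simp only: Gadd Suc.IH funpow.simps o_apply)
  qed (simp add: G0)
  have *: "G 1 ** G (-1) = mat 1" "G (-1) ** G 1 = mat 1"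
    using Gadd[of 1 "-1"] Gadd[of "-1" 1] G0 by simp_all
  then have "G 1 ** matrix_inv (G 1) = mat 1 \<and> matrix_inv (G 1) ** G 1 = mat 1"
    unfolding matrix_inv_def by (intro someI_ex[of "\<lambda>B. G 1 ** B = mat 1 \<and> B ** G 1 = mat 1"]) blast
  then have "matrix_inv (G 1) = (G (-1) ** G 1) ** matrix_inv (G 1)"
    using * by simp
  also have "\<dots> = G (-1)"
    using \<open>_ \<and> _\<close> by (simp flip: matrix_mul_assoc)
  finally show ?thesis
    unfolding mat_powi_def by (simp add: pw)
qed

definition clock_pow :: "int \<Rightarrow> 'n::{finite,linorder} cmat" where
  "clock_pow k = (\<chi> i j. if i = j then half_root CARD('n) (2 * (k * int (pos i))) else 0)"

definition shift_pow :: "int \<Rightarrow> 'n::{finite,linorder} cmat" where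
  "shift_pow k = (\<chi> i j. if j = site (int (pos i) + k) then 1 else 0)"

lemma mat_powi_clock: "mat_powi clock k = (clock_pow k :: 'n::{finite,linorder} cmat)"
proof -
  have "exp (2 * of_real pi * \<i> / of_nat CARD('n)) = half_root CARD('n) 2"
    by (simp add: half_root_def cis_conv_exp mult_ac)
  then have "clock = (clock_pow 1 :: 'n cmat)"
    by (simp add: clock_def clock_pow_def vec_eq_iff half_root_mult_nat)
  moreover have "mat_powi (clock_pow 1) k = (clock_pow k :: 'n cmat)"
  proof (rule mat_powi_eqI)
    show "clock_pow 0 = (mat 1 :: 'n cmat)"
      by (simp add: clock_pow_def mat_def vec_eq_iff)
    show "clock_pow (a + b) = clock_pow a ** (clock_pow b :: 'n cmat)" for a b
    proof -
      have "(clock_pow a ** clock_pow b) $ i $ j = clock_pow (a + b) $ i $ j" for i j :: 'n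
        by (subst sparse_row_mult[where s = i])
          (auto simp: clock_pow_def half_root_add distrib_left distrib_right)
      then show ?thesis by (simp add: vec_eq_iff)
    qed
  qed
  ultimately show ?thesis by simp
qed

lemma site_pos [simp]: "site (int (pos i)) = i"
  by (rule sym) (simp add: eq_site_iff)

lemma mat_powi_shift: "mat_powi shift k = (shift_pow k :: 'n::{finite,linorder} cmat)"
proof -
  have "pos j = (pos i + 1) mod CARD('n) \<longleftrightarrow> j = site (int (pos i) + 1)" for i j :: 'n
  proof -
    have "j = site (int (pos i) + 1) \<longleftrightarrow> int (pos j) = int ((pos i + 1) mod CARD('n))"
      unfolding eq_site_iff using pos_less[of j] by (simp add: zmod_int add.commute)
    then show ?thesis
      by (simp only: of_nat_eq_iff)
  qed
  then have "shift = (shift_pow 1 :: 'n cmat)"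
    by (simp add: shift_def shift_pow_def vec_eq_iff)
  moreover have "mat_powi (shift_pow 1) k = (shift_pow k :: 'n cmat)"
  proof (rule mat_powi_eqI)
    show "shift_pow 0 = (mat 1 :: 'n cmat)"
      by (auto simp: shift_pow_def mat_def vec_eq_iff)
    show "shift_pow (a + b) = shift_pow a ** (shift_pow b :: 'n cmat)" for a b
    proof -
      have "(shift_pow a ** shift_pow b) $ i $ j = shift_pow (a + b) $ i $ j" for i j :: 'n
        by (subst sparse_row_mult[where s = "site (int (pos i) + a)"])
          (auto simp: shift_pow_def site_pos_add add.assoc)
      then show ?thesis by (simp add: vec_eq_iff)
    qed
  qed
  ultimately show ?thesis by simp
qed

text \<open>The shift power selects the column reached from row i, and the clock power multiplies by
  omega to the power \<open>fst k\<close> times the position of the row.\<close>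

lemma T_mat_nth:
  "T_mat k $ i $ j = (if j = site (int (pos i) + snd k)
     then zcoef CARD('n) * half_root CARD('n) (fst k * snd k + 2 * (fst k * int (pos i))) else 0)"
  for i j :: "'n::{finite,linorder}"
proof -
  have "exp (of_real pi * \<i> / of_nat CARD('n)) = cis (pi / real CARD('n))"
    by (simp add: cis_conv_exp mult_ac)
  then have "exp (of_real pi * \<i> / of_nat CARD('n)) powi m = half_root CARD('n) m" for m
    by (simp add: cis_power_int half_root_def mult_ac)
  moreover have "(clock_pow (fst k) ** shift_pow (snd k)) $ i $ j = (if j = site (int (pos i) + snd k)
      then half_root CARD('n) (2 * (fst k * int (pos i))) else 0)"
    by (subst sparse_row_mult[where s = i]) (auto simp: clock_pow_def shift_pow_def)
  ultimately show ?thesis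
    by (simp add: T_mat_def mat_powi_clock mat_powi_shift mat_mult_eq_cscale zcoef_def half_root_add)
qed

text \<open>The Weyl relation: moving V^(k2) past U^(l1) costs omega^(k2 l1). The symmetric phases
  in \<open>T_mat\<close> absorb half of (k1 l2 + k2 l1), leaving omega^((k2 l1 - k1 l2)/2).\<close>

lemma T_mat_mult:
  "T_mat k ** T_mat l = cscale (zcoef CARD('n) * half_root CARD('n) (- cross2 k l))
     (T_mat (k + l) :: 'n::{finite,linorder} cmat)"
proof -
  let ?h = "half_root CARD('n)" and ?c = "zcoef CARD('n)"
  have "(T_mat k ** T_mat l) $ i $ j = ?c * ?h (- cross2 k l) * T_mat (k + l) $ i $ j" for i j :: 'n
  proof -
    define p where "p = int (pos i)"
    have s: "site (int (pos (site (p + snd k) :: 'n)) + snd l) = (site (p + (snd k + snd l)) :: 'n)"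
      by (simp add: site_pos_add add.assoc)
    have "(T_mat k ** T_mat l) $ i $ j = (if j = site (p + (snd k + snd l)) then
        ?c * ?h (fst k * snd k + 2 * (fst k * p)) *
        (?c * ?h (fst l * snd l + 2 * (fst l * int (pos (site (p + snd k) :: 'n))))) else 0)"
      by (subst sparse_row_mult[where s = "site (p + snd k)"])
        (auto simp: T_mat_nth s p_def[symmetric])
    also have "?h (fst l * snd l + 2 * (fst l * int (pos (site (p + snd k) :: 'n)))) =
        ?h (fst l * snd l + 2 * (fst l * (p + snd k)))"
      by (simp add: half_root_add half_root_pos_site)
    also have "(if j = site (p + (snd k + snd l)) then
        ?c * ?h (fst k * snd k + 2 * (fst k * p)) *
        (?c * ?h (fst l * snd l + 2 * (fst l * (p + snd k)))) else 0) =
        ?c * ?h (- cross2 k l) * T_mat (k + l) $ i $ j"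
    proof -
      have "?h (fst k * snd k + 2 * (fst k * p)) * ?h (fst l * snd l + 2 * (fst l * (p + snd k))) =
          ?h (- cross2 k l) * ?h (fst (k + l) * snd (k + l) + 2 * (fst (k + l) * p))"
        unfolding half_root_add[symmetric] by (rule arg_cong[of _ _ ?h]) (simp add: cross2_def algebra_simps)
      then show ?thesis
        by (simp add: T_mat_nth p_def[symmetric] mult_ac)
    qed
    finally show ?thesis .
  qed
  then show ?thesis by (simp add: vec_eq_iff)
qed

lemma T_mat_0: "T_mat 0 = cscale (zcoef CARD('n)) (mat 1 :: 'n::{finite,linorder} cmat)"
  by (auto simp: vec_eq_iff T_mat_nth mat_def)

text \<open>Without its prefactor \<open>T_mat k\<close> is unitary with inverse at -k; the sign
  comes from conjugating the purely imaginary \<open>zcoef\<close>. This is what makes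
  \<open>X_mat\<close> and \<open>Y_mat\<close> skew-Hermitian.\<close>

lemma dagger_T_mat: "dagger (T_mat k) = - (T_mat (- k) :: 'n::{finite,linorder} cmat)"
proof -
  have "cnj (T_mat k $ j $ i) = - T_mat (- k) $ i $ j" for i j :: 'n
  proof -
    have iff: "i = site (int (pos j) + snd k) \<longleftrightarrow> j = site (int (pos i) - snd k)"
      unfolding eq_site_iff mod_eq_dvd_iff by (subst dvd_minus_iff[symmetric]) (simp add: algebra_simps)
    show ?thesis
    proof (cases "i = site (int (pos j) + snd k)")
      case True
      have "fst (- k) * snd (- k) + 2 * (fst (- k) * int (pos i)) =
          fst k * snd k + 2 * (- fst k * int (pos i))"
        by simp
      then have "half_root CARD('n) (fst (- k) * snd (- k) + 2 * (fst (- k) * int (pos i))) =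
          half_root CARD('n) (fst k * snd k) * half_root CARD('n) (2 * (- fst k * int (pos i)))"
        by (simp only: half_root_add)
      also have "half_root CARD('n) (2 * (- fst k * int (pos i))) =
          half_root CARD('n) (2 * (- fst k * (int (pos j) + snd k)))"
        unfolding True by (rule half_root_pos_site)
      also have "half_root CARD('n) (fst k * snd k) * \<dots> =
          half_root CARD('n) (- (fst k * snd k + 2 * (fst k * int (pos j))))"
        unfolding half_root_add[symmetric]
        by (rule arg_cong[of _ _ "half_root _"]) (simp add: algebra_simps)
      finally have "T_mat (- k) $ i $ j =
          zcoef CARD('n) * half_root CARD('n) (- (fst k * snd k + 2 * (fst k * int (pos j))))"
        using True iff by (simp add: T_mat_nth)
      moreover have "cnj (T_mat k $ j $ i) =
          - zcoef CARD('n) * half_root CARD('n) (- (fst k * snd k + 2 * (fst k * int (pos j))))"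
        using True by (simp add: T_mat_nth cnj_half_root cnj_zcoef del: minus_add_distrib)
      ultimately show ?thesis by simp
    next
      case False
      then show ?thesis using iff by (simp add: T_mat_nth)
    qed
  qed
  then show ?thesis by (simp add: vec_eq_iff)
qed

text \<open>Congruence of k and l modulo N is expressed throughout as
  \<open>null_mod N (k - l)\<close>.\<close>

definition null_mod :: "nat \<Rightarrow> int \<times> int \<Rightarrow> bool" where
  "null_mod N k \<longleftrightarrow> int N dvd fst k \<and> int N dvd snd k"

lemma null_mod_minus [simp]: "null_mod N (- k) \<longleftrightarrow> null_mod N k"
  by (simp add: null_mod_def)

text \<open>The clock and shift powers are periodic, but the phase omega^(k1 k2 / 2) is so only up
  to sign; hence the factor z.\<close>

lemma T_mat_periodic:
  assumes "null_mod CARD('n) (k - l)"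
  shows "\<exists>z. T_mat k = cscale z (T_mat l :: 'n::{finite,linorder} cmat)"
proof -
  have "T_mat k $ i $ j = half_root CARD('n) (fst k * snd k - fst l * snd l) * T_mat l $ i $ j"
    for i j :: 'n
  proof -
    have "(site (int (pos i) + snd k) :: 'n) = site (int (pos i) + snd l)"
      unfolding eq_site_iff pos_site mod_mod_trivial mod_eq_dvd_iff
      using assms by (simp add: null_mod_def)
    moreover have "half_root CARD('n) (2 * (fst k * int (pos i))) =
        half_root CARD('n) (2 * (fst l * int (pos i)))"
      using assms by (intro half_root_double_cong) (auto simp: null_mod_def simp flip: left_diff_distrib)
    moreover have "half_root CARD('n) (fst k * snd k) =
        half_root CARD('n) (fst k * snd k - fst l * snd l) * half_root CARD('n) (fst l * snd l)"
      by (simp flip: half_root_add)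
    ultimately show ?thesis
      by (simp add: T_mat_nth half_root_add mult_ac)
  qed
  then show ?thesis
    by (intro exI[of _ "half_root CARD('n) (fst k * snd k - fst l * snd l)"]) (simp add: vec_eq_iff)
qed

text \<open>Conjugation by T multiplies T k by a phase, which is nontrivial for a suitable T.\<close>

lemma trace_T_mat:
  assumes "\<not> null_mod CARD('n) k"
  shows "trace (T_mat k :: 'n::{finite,linorder} cmat) = 0"
proof -
  let ?c = "zcoef CARD('n)" and ?h = "half_root CARD('n)"
  \<comment> \<open>The cross product is nondegenerate modulo N: a unit vector extracts, up to sign,
    whichever coordinate of k is nonzero there.\<close>
  obtain l where l: "\<not> int CARD('n) dvd cross2 l k"
  proof (cases "int CARD('n) dvd snd k")
    case True
    then show ?thesis
      using assms that[of "(0, 1)"] by (simp add: null_mod_def cross2_def)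
  next
    case False
    then show ?thesis
      using that[of "(1, 0)"] by (simp add: cross2_def)
  qed
  have "trace ((T_mat l ** T_mat k) ** T_mat (- l) :: 'n cmat) =
      trace ((T_mat (- l) ** T_mat l) ** T_mat k :: 'n cmat)"
    by (metis trace_mul_sym matrix_mul_assoc)
  moreover have "T_mat (- l) ** T_mat l = cscale (?c * ?c) (mat 1 :: 'n cmat)"
    by (simp add: T_mat_mult T_mat_0 cross2_def)
  moreover have "(T_mat l ** T_mat k) ** T_mat (- l) =
      cscale (?c * ?c * ?h (2 * - cross2 l k)) (T_mat k :: 'n cmat)"
  proof -
    have "?h (- cross2 l k) * ?h (- cross2 (l + k) (- l)) = ?h (2 * - cross2 l k)"
      unfolding half_root_add[symmetric] by (rule arg_cong[of _ _ ?h]) (simp add: cross2_def algebra_simps)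
    then show ?thesis
      by (simp add: T_mat_mult cscale_mult_left mult_ac)
  qed
  ultimately have "?h (2 * - cross2 l k) * trace (T_mat k :: 'n cmat) = trace (T_mat k :: 'n cmat)"
    using zcoef_nonzero[of "CARD('n)"] by (simp add: trace_cscale cscale_mult_left)
  moreover have "?h (2 * - cross2 l k) \<noteq> 1"
    using l half_root_eq_1_iff[of "CARD('n)" "- cross2 l k"] by simp
  ultimately show ?thesis
    by (metis mult_cancel_right1 mult.commute)
qed

text \<open>The difference of the phases for k l and l k is -2 i times a sine; multiplied by the
  imaginary \<open>zcoef\<close> it becomes real with a minus sign. Its square is the sine weight of
  the theorem.\<close>

definition struct_const :: "nat \<Rightarrow> int \<times> int \<Rightarrow> int \<times> int \<Rightarrow> real" where
  "struct_const N k l = - (real N / pi * sin (pi / real N * real_of_int (cross2 k l)))"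

lemma commutator_T_mat:
  "commutator (T_mat k) (T_mat l) =
     cscale (struct_const CARD('n) k l) (T_mat (k + l) :: 'n::{finite,linorder} cmat)"
proof -
  let ?N = "CARD('n)"
  have "half_root ?N (- m) - half_root ?N m = - (\<i> * of_real (2 * sin (pi / real ?N * real_of_int m)))"
    for m
    by (simp add: half_root_def complex_eq_iff)
  moreover have "- (\<i> * of_real a) * - (\<i> * of_real b) = of_real (- (a * b))" for a b :: real
    by (simp add: complex_eq_iff)
  ultimately have "zcoef ?N * (half_root ?N (- cross2 k l) - half_root ?N (cross2 k l)) =
      of_real (- (real ?N / (2 * pi) * (2 * sin (pi / real ?N * real_of_int (cross2 k l)))))"
    by (simp only: zcoef_def)
  also have "- (real ?N / (2 * pi) * (2 * sin (pi / real ?N * real_of_int (cross2 k l)))) =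
      struct_const ?N k l"
    by (simp add: struct_const_def)
  finally have "zcoef ?N * (half_root ?N (- cross2 k l) - half_root ?N (cross2 k l)) =
      struct_const ?N k l" .
  moreover have "cross2 l k = - cross2 k l"
    by (simp add: cross2_def algebra_simps)
  ultimately have "zcoef ?N * half_root ?N (- cross2 k l) - zcoef ?N * half_root ?N (- cross2 l k) =
      struct_const ?N k l"
    by (simp only: right_diff_distrib minus_minus)
  then show ?thesis
    by (simp add: commutator_def T_mat_mult add.commute[of l k] flip: cscale_diff_left)
qed

section \<open>Indices modulo N\<close>

lemma Z_N_iff:
  assumes "int N = 2 * M + 1"
  shows "k \<in> Z_N N \<longleftrightarrow> - M \<le> fst k \<and> fst k \<le> M \<and> - M \<le> snd k \<and> snd k \<le> M \<and> k \<noteq> 0"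
  using assms by (cases k) (auto simp: Z_N_def Let_def zero_prod_def)

lemma finite_Z_N: "finite (Z_N N)"
  by (simp add: Z_N_def Let_def)

lemma odd_nat_obtain:
  assumes "odd (N :: nat)"
  obtains M where "int N = 2 * M + 1" "M \<ge> 0"
proof -
  obtain m where "N = 2 * m + 1"
    using assms by (auto elim: oddE)
  then show ?thesis
    using that[of "int m"] by simp
qed

lemma minus_in_Z_N: "odd N \<Longrightarrow> k \<in> Z_N N \<Longrightarrow> - k \<in> Z_N N"
  by (erule odd_nat_obtain) (auto simp: Z_N_iff)

lemma small_multiple_eq_0:
  fixes x :: int
  assumes "n dvd x" "\<bar>x\<bar> < n"
  shows "x = 0"
  using assms zdvd_not_zless[of "\<bar>x\<bar>" n] by (cases "x = 0") auto

text \<open>Coordinates differ by at most 2 M = N - 1 in modulus, so divisibility by N forces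
  equality.\<close>

lemma Z_N_unique:
  assumes N: "odd N" and k: "k \<in> Z_N N" and l: "l \<in> Z_N N" and kl: "null_mod N (k - l)"
  shows "k = l"
proof -
  obtain M where M: "int N = 2 * M + 1" "M \<ge> 0"
    using N by (rule odd_nat_obtain)
  have "fst k - fst l = 0"
    by (rule small_multiple_eq_0[of "int N"]) (use k l kl M in \<open>auto simp: Z_N_iff null_mod_def\<close>)
  moreover have "snd k - snd l = 0"
    by (rule small_multiple_eq_0[of "int N"]) (use k l kl M in \<open>auto simp: Z_N_iff null_mod_def\<close>)
  ultimately show ?thesis by (simp add: prod_eq_iff)
qed

lemma Z_N_not_null:
  assumes N: "odd N" and k: "k \<in> Z_N N"
  shows "\<not> null_mod N k"
proof
  assume kn: "null_mod N k"
  obtain M where M: "int N = 2 * M + 1" "M \<ge> 0"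
    using N by (rule odd_nat_obtain)
  have "fst k = 0" "snd k = 0"
    using k kn M by (auto simp: Z_N_iff null_mod_def intro!: small_multiple_eq_0[of "int N"])
  then show False
    using k M by (simp add: Z_N_iff prod_eq_iff)
qed

lemma minus_neq_in_Z_N:
  assumes "odd N" "k \<in> Z_N N"
  shows "- k \<noteq> k"
  using assms by (auto elim!: odd_nat_obtain simp: Z_N_iff prod_eq_iff)

lemma null_mod_diff_red: "null_mod N (k - red N k)"
proof -
  have "n dvd x - ((x + m) mod n - m)" for n x m :: int
  proof -
    have "n dvd (x + m) - (x + m) mod n"
      by (rule dvd_minus_mod)
    then show ?thesis by (simp add: algebra_simps)
  qed
  then show ?thesis
    by (simp add: null_mod_def red_def Let_def)
qed

lemma null_mod_trans: "null_mod N (k - l) \<Longrightarrow> null_mod N (l - m) \<Longrightarrow> null_mod N (k - m)"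
  unfolding null_mod_def using dvd_add[of "int N" "fst k - fst l" "fst l - fst m"]
    dvd_add[of "int N" "snd k - snd l" "snd l - snd m"] by simp

lemma null_mod_sym: "null_mod N (k - l) \<Longrightarrow> null_mod N (l - k)"
  using null_mod_minus[of N "k - l"] by simp

lemma red_in_Z_N:
  assumes N: "odd N" and k: "\<not> null_mod N k"
  shows "red N k \<in> Z_N N"
proof -
  obtain M where M: "int N = 2 * M + 1" "M \<ge> 0"
    using N by (rule odd_nat_obtain)
  have r: "- M \<le> (x + M) mod int N - M" "(x + M) mod int N - M \<le> M" for x
    using pos_mod_bound[of "int N" "x + M"] pos_mod_sign[of "int N" "x + M"] M by auto
  have "red N k \<noteq> 0"
    using null_mod_diff_red[of N k] k by auto
  moreover have "(int N - 1) div 2 = M"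
    using M by simp
  ultimately show ?thesis
    using r by (simp add: Z_N_iff[OF M(1)] red_def Let_def)
qed

lemma red_eqI:
  assumes N: "odd N" and j: "j \<in> Z_N N" and kj: "null_mod N (k - j)"
  shows "red N k = j"
proof (rule Z_N_unique[OF N _ j])
  have "\<not> null_mod N k"
  proof
    assume "null_mod N k"
    then have "null_mod N (j - 0)"
      using null_mod_trans[of N j k 0] null_mod_sym[OF kj] by simp
    then show False
      using Z_N_not_null[OF N j] by simp
  qed
  then show "red N k \<in> Z_N N"
    by (rule red_in_Z_N[OF N])
  show "null_mod N (red N k - j)"
    using null_mod_trans[OF null_mod_sym[OF null_mod_diff_red] kj] .
qed

lemma Z_N_plus_subset: "Z_N_plus N \<subseteq> Z_N N"
  by (auto simp: Z_N_plus_def)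

lemma Z_N_plus_not_minus: "k \<in> Z_N_plus N \<Longrightarrow> - k \<notin> Z_N_plus N"
  by (auto simp: Z_N_plus_def)

lemma sum_Z_N:
  fixes f :: "int \<times> int \<Rightarrow> 'a::comm_monoid_add"
  assumes N: "odd N"
  shows "sum f (Z_N N) = (\<Sum>i\<in>Z_N_plus N. f i + f (- i))"
proof -
  have "Z_N N = Z_N_plus N \<union> uminus ` Z_N_plus N"
  proof (intro equalityI subsetI)
    fix k assume k: "k \<in> Z_N N"
    then have "k \<noteq> 0"
      using N by (auto elim!: odd_nat_obtain simp: Z_N_iff)
    then have "k \<in> Z_N_plus N \<or> - k \<in> Z_N_plus N"
      using k minus_in_Z_N[OF N k] by (auto simp: Z_N_plus_def prod_eq_iff)
    then show "k \<in> Z_N_plus N \<union> uminus ` Z_N_plus N"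
      by (metis UnI1 UnI2 image_eqI minus_minus)
  next
    fix k assume "k \<in> Z_N_plus N \<union> uminus ` Z_N_plus N"
    then show "k \<in> Z_N N"
      using Z_N_plus_subset minus_in_Z_N[OF N] by blast
  qed
  moreover have "Z_N_plus N \<inter> uminus ` Z_N_plus N = {}"
    using Z_N_plus_not_minus by auto
  moreover have "finite (Z_N_plus N)"
    using finite_subset[OF Z_N_plus_subset finite_Z_N] .
  ultimately show ?thesis
    by (simp add: sum.union_disjoint sum.reindex inj_on_def sum.distrib)
qed

lemma sum_Z_N_minus:
  assumes N: "odd N"
  shows "(\<Sum>i\<in>Z_N N. f (- i)) = sum f (Z_N N)"
  by (rule sum.reindex_bij_witness[of _ uminus uminus]) (auto simp: minus_in_Z_N[OF N])

text \<open>The value 0 on the zero class is the true eigenvalue of \<open>multiplier\<close> on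
  scalar matrices, and since inverse 0 = 0 the extension commutes with taking inverses.\<close>

definition extend_mod :: "nat \<Rightarrow> (int \<times> int \<Rightarrow> real) \<Rightarrow> int \<times> int \<Rightarrow> real" where
  "extend_mod N f k = (if null_mod N k then 0 else f (red N k))"

lemma extend_mod_Z_N: "odd N \<Longrightarrow> k \<in> Z_N N \<Longrightarrow> extend_mod N f k = f k"
  using red_eqI[of N k k] by (simp add: extend_mod_def Z_N_not_null) (simp add: null_mod_def)

lemma extend_mod_minus:
  assumes N: "odd N" and f: "\<And>k. k \<in> Z_N N \<Longrightarrow> f (- k) = f k"
  shows "extend_mod N f (- k) = extend_mod N f k"
proof (cases "null_mod N k")
  case False
  have "null_mod N (- k - (- red N k))"
    using null_mod_minus[of N "k - red N k"] null_mod_diff_red by simp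
  then have "red N (- k) = - red N k"
    by (intro red_eqI[OF N] minus_in_Z_N[OF N] red_in_Z_N[OF N False])
  then show ?thesis
    using False f[OF red_in_Z_N[OF N False]] by (simp add: extend_mod_def)
qed (simp add: extend_mod_def)

lemma extend_mod_inverse: "extend_mod N (\<lambda>j. inverse (f j)) k = inverse (extend_mod N f k)"
  by (simp add: extend_mod_def)

section \<open>Fourier coefficients\<close>

text \<open>The trace of T_(-k) T_k, namely the square of \<open>zcoef\<close> times the trace N of
  the identity.\<close>

definition trace_norm :: "nat \<Rightarrow> real" where
  "trace_norm N = - (real N ^ 3 / (4 * pi\<^sup>2))"

lemma trace_norm_neq_0: "N > 0 \<Longrightarrow> trace_norm N \<noteq> 0"
  by (simp add: trace_norm_def)

lemma zcoef_square: "zcoef N * zcoef N * of_nat N = of_real (trace_norm N)"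
proof -
  have "- (\<i> * of_real a) * - (\<i> * of_real a) * of_nat N = of_real (- (a * a * real N))" for a :: real
    by (simp add: complex_eq_iff)
  then have "zcoef N * zcoef N * of_nat N =
      of_real (- (real N / (2 * pi) * (real N / (2 * pi)) * real N))"
    by (simp only: zcoef_def)
  also have "- (real N / (2 * pi) * (real N / (2 * pi)) * real N) = trace_norm N"
    by (simp add: trace_norm_def power2_eq_square power3_eq_cube)
  finally show ?thesis .
qed

text \<open>Pairing with T_(-k) rather than with a conjugate transpose keeps the coefficient complex
  linear in u; the division normalizes the coefficient of T_k itself to 1.\<close>

definition coeff_T :: "int \<times> int \<Rightarrow> 'n::{finite,linorder} cmat \<Rightarrow> complex" where
  "coeff_T k u = trace (T_mat (- k) ** u) / of_real (trace_norm CARD('n))"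

lemma trace_T_mat_mult:
  "trace (T_mat k ** u) = of_real (trace_norm CARD('n)) * coeff_T (- k) (u :: 'n::{finite,linorder} cmat)"
  using trace_norm_neq_0[of "CARD('n)"] by (simp add: coeff_T_def)

lemma coeff_T_add: "coeff_T k (u + v) = coeff_T k u + coeff_T k v"
  by (simp add: coeff_T_def matrix_add_ldistrib trace_add add_divide_distrib)

lemma coeff_T_diff: "coeff_T k (u - v) = coeff_T k u - coeff_T k v"
  by (simp add: coeff_T_def matrix_diff_ldistrib trace_sub diff_divide_distrib)

lemma coeff_T_cscale: "coeff_T k (cscale z u) = z * coeff_T k u"
  by (simp add: coeff_T_def cscale_mult_right trace_cscale)

lemma coeff_T_sum: "coeff_T k (sum f S) = (\<Sum>i\<in>S. coeff_T k (f i))"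
  by (simp add: coeff_T_def matrix_sum_right trace_sum sum_divide_distrib)

lemma coeff_T_T_mat_self: "coeff_T k (T_mat k :: 'n::{finite,linorder} cmat) = 1"
proof -
  have "trace (T_mat (- k) ** T_mat k :: 'n cmat) = of_real (trace_norm CARD('n))"
    by (simp add: T_mat_mult T_mat_0 cross2_def trace_cscale trace_I zcoef_square)
  then show ?thesis
    using trace_norm_neq_0[of "CARD('n)"] by (simp add: coeff_T_def)
qed

lemma coeff_T_T_mat_other:
  assumes "\<not> null_mod CARD('n) (k - j)"
  shows "coeff_T j (T_mat k :: 'n::{finite,linorder} cmat) = 0"
  using trace_T_mat[OF assms] by (simp add: coeff_T_def T_mat_mult trace_cscale)

text \<open>Taking the conjugate transpose gives one minus sign from u and one from the T matrix;
  they cancel, leaving the reality condition on Fourier coefficients.\<close>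

lemma cnj_coeff_T:
  assumes "u \<in> su"
  shows "cnj (coeff_T k u) = coeff_T (- k) (u :: 'n::{finite,linorder} cmat)"
proof -
  have "cnj (trace (T_mat (- k) ** u)) = trace (T_mat k ** u)"
    unfolding trace_dagger[symmetric] dagger_mult dagger_T_mat su_dagger[OF assms]
    by (simp add: matrix_minus_left matrix_minus_right trace_mul_sym[of u])
  then show ?thesis by (simp add: coeff_T_def)
qed

text \<open>Inverse Fourier transform: summing over the clock exponent isolates a single entry of u.\<close>

lemma eq_0_if_trace_T_mat_mult_eq_0:
  fixes u :: "'n::{finite,linorder} cmat"
  assumes "\<And>k. trace (T_mat k ** u) = 0"
  shows "u = 0"
proof -
  let ?N = "CARD('n)" and ?h = "half_root CARD('n)"
  have "u $ j $ i = 0" for i j :: 'n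
  proof -
    \<comment> \<open>A shift by b leads from row i to column j, so the trace against
      \<open>T_mat (a, b)\<close> contains the entry u $ j $ i.\<close>
    define b where "b = int (pos j) - int (pos i)"
    have "(T_mat (a, b) ** u) $ p $ p =
        zcoef ?N * ?h (a * b + 2 * (a * int (pos p))) * u $ (site (int (pos p) + b)) $ p" for a p
      by (subst sparse_row_mult[where s = "site (int (pos p) + b)"]) (simp_all add: T_mat_nth)
    then have tr: "trace (T_mat (a, b) ** u) =
        (\<Sum>p\<in>UNIV. zcoef ?N * ?h (a * b + 2 * (a * int (pos p))) * u $ (site (int (pos p) + b)) $ p)" for a
      by (simp only: trace_def)
    define v where "v p = zcoef ?N * u $ (site (int (pos p) + b)) $ p" for p :: 'n
    have "0 = (\<Sum>n<?N. ?h (- (int n * b) - 2 * (int n * int (pos i))) * trace (T_mat (int n, b) ** u))"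
      by (simp add: assms)
    also have "\<dots> = (\<Sum>n<?N. \<Sum>p\<in>UNIV. v p * ?h (2 * (int (pos p) - int (pos i)) * int n))"
    proof (intro sum.cong refl)
      fix n
      have *: "?h (- (int n * b) - 2 * (int n * int (pos i))) * ?h (int n * b + 2 * (int n * int (pos p)))
          = ?h (2 * (int (pos p) - int (pos i)) * int n)" for p :: 'n
        unfolding half_root_add[symmetric] by (rule arg_cong[of _ _ ?h]) (simp add: algebra_simps)
      have "?h (- (int n * b) - 2 * (int n * int (pos i))) *
          (zcoef ?N * ?h (int n * b + 2 * (int n * int (pos p))) * u $ (site (int (pos p) + b)) $ p) =
          v p * ?h (2 * (int (pos p) - int (pos i)) * int n)" for p :: 'n
        unfolding v_def *[symmetric] by (simp only: mult_ac)
      then show "?h (- (int n * b) - 2 * (int n * int (pos i))) * trace (T_mat (int n, b) ** u) =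
          (\<Sum>p\<in>UNIV. v p * ?h (2 * (int (pos p) - int (pos i)) * int n))"
        unfolding tr sum_distrib_left by (intro sum.cong refl)
    qed
    also have "\<dots> = (\<Sum>p\<in>UNIV. v p * (\<Sum>n<?N. ?h (2 * (int (pos p) - int (pos i)) * int n)))"
      by (subst sum.swap) (simp add: sum_distrib_left)
    also have "\<dots> = (\<Sum>p\<in>UNIV. if p = i then v i * of_nat ?N else 0)"
    proof (intro sum.cong refl)
      fix p :: 'n
      have "int ?N dvd int (pos p) - int (pos i) \<longleftrightarrow> p = site (int (pos i))"
        unfolding eq_site_iff mod_eq_dvd_iff ..
      then show "v p * (\<Sum>n<?N. ?h (2 * (int (pos p) - int (pos i)) * int n)) =
          (if p = i then v i * of_nat ?N else 0)"
        by (simp only: sum_half_root[OF zero_less_card_finite]) simp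
    qed
    also have "\<dots> = v i * of_nat ?N"
      by simp
    finally have "v i = 0"
      by simp
    then show ?thesis
      using zcoef_nonzero[of ?N] by (simp add: v_def b_def)
  qed
  then show ?thesis by (simp add: vec_eq_iff)
qed

text \<open>Up to a factor \<open>T_mat k\<close> depends only on the class of k. The nonzero
  classes are represented in \<open>Z_N\<close>, while the zero class consists of scalar matrices
  and is controlled by the trace.\<close>

lemma eq_if_coeff_T_eq:
  fixes u v :: "'n::{finite,linorder} cmat"
  assumes N: "odd CARD('n)" and tr: "trace u = trace v"
    and c: "\<And>k. k \<in> Z_N CARD('n) \<Longrightarrow> coeff_T k u = coeff_T k v"
  shows "u = v"
proof -
  have "trace (T_mat k ** (u - v)) = 0" for k
  proof (cases "null_mod CARD('n) k")
    case True
    then obtain z where "T_mat k = cscale z (T_mat 0 :: 'n cmat)"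
      using T_mat_periodic[of k 0] by auto
    then show ?thesis
      by (simp add: T_mat_0 cscale_mult_left trace_cscale trace_sub tr)
  next
    case False
    let ?r = "red CARD('n) k"
    have r: "- ?r \<in> Z_N CARD('n)"
      by (intro minus_in_Z_N red_in_Z_N N False)
    obtain z where z: "T_mat k = cscale z (T_mat ?r :: 'n cmat)"
      using T_mat_periodic[OF null_mod_diff_red] by blast
    have "trace (T_mat ?r ** (u - v)) = 0"
      using c[OF r] by (simp add: trace_T_mat_mult coeff_T_diff)
    then show ?thesis
      by (simp add: z cscale_mult_left trace_cscale)
  qed
  then have "u - v = 0"
    by (rule eq_0_if_trace_T_mat_mult_eq_0)
  then show ?thesis by simp
qed

text \<open>The complex-linear counterpart of L, defined on all matrices. Omitting the index 0 makes
  it annihilate scalar matrices.\<close>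

definition multiplier :: "(int \<times> int \<Rightarrow> real) \<Rightarrow> 'n::{finite,linorder} cmat \<Rightarrow> 'n cmat" where
  "multiplier f u = (\<Sum>j\<in>Z_N CARD('n). cscale (of_real (f j) * coeff_T j u) (T_mat j))"

lemma multiplier_add: "multiplier f (u + v) = multiplier f u + multiplier f v"
  by (simp add: multiplier_def coeff_T_add distrib_left cscale_add_left sum.distrib)

lemma multiplier_cscale: "multiplier f (cscale z u) = cscale z (multiplier f u)"
  by (simp add: multiplier_def coeff_T_cscale cscale_sum mult.left_commute)

lemma trace_multiplier:
  assumes "odd CARD('n)"
  shows "trace (multiplier f (u :: 'n::{finite,linorder} cmat)) = 0"
  unfolding multiplier_def trace_sum
  by (rule sum.neutral) (simp add: trace_cscale trace_T_mat Z_N_not_null[OF assms])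

lemma coeff_T_multiplier:
  assumes N: "odd CARD('n)" and k: "k \<in> Z_N CARD('n)"
  shows "coeff_T k (multiplier f (u :: 'n::{finite,linorder} cmat)) = of_real (f k) * coeff_T k u"
proof -
  have "coeff_T k (multiplier f u) =
      (\<Sum>j\<in>Z_N CARD('n). of_real (f j) * coeff_T j u * coeff_T k (T_mat j :: 'n cmat))"
    by (simp add: multiplier_def coeff_T_sum coeff_T_cscale)
  also have "\<dots> = (\<Sum>j\<in>Z_N CARD('n). if j = k then of_real (f k) * coeff_T k u else 0)"
  proof (intro sum.cong refl)
    fix j assume j: "j \<in> Z_N CARD('n)"
    show "of_real (f j) * coeff_T j u * coeff_T k (T_mat j :: 'n cmat) =
        (if j = k then of_real (f k) * coeff_T k u else 0)"
    proof (cases "j = k")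
      case False
      then have "\<not> null_mod CARD('n) (j - k)"
        using Z_N_unique[OF N j k] by blast
      then show ?thesis
        using False by (simp add: coeff_T_T_mat_other)
    qed (simp add: coeff_T_T_mat_self)
  qed
  also have "\<dots> = of_real (f k) * coeff_T k u"
    using k by (simp add: finite_Z_N)
  finally show ?thesis .
qed

text \<open>Commutators produce indices k + l outside \<open>Z_N\<close>, possibly in the zero
  class, so the eigenvalue equation is needed for every integer index.\<close>

lemma multiplier_T_mat:
  assumes N: "odd CARD('n)"
  shows "multiplier f (T_mat k) =
    cscale (of_real (extend_mod CARD('n) f k)) (T_mat k :: 'n::{finite,linorder} cmat)"
proof (rule eq_if_coeff_T_eq[OF N])
  show "trace (multiplier f (T_mat k :: 'n cmat)) =
      trace (cscale (of_real (extend_mod CARD('n) f k)) (T_mat k :: 'n cmat))"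
    by (simp add: trace_multiplier[OF N] trace_cscale extend_mod_def trace_T_mat)
  fix j assume j: "j \<in> Z_N CARD('n)"
  show "coeff_T j (multiplier f (T_mat k :: 'n cmat)) =
      coeff_T j (cscale (of_real (extend_mod CARD('n) f k)) (T_mat k :: 'n cmat))"
  proof (cases "null_mod CARD('n) (k - j)")
    case True
    then have "extend_mod CARD('n) f k = f j"
      using red_eqI[OF N j True] Z_N_not_null[OF N j] null_mod_trans[of _ j k 0] null_mod_sym[OF True]
      by (auto simp: extend_mod_def)
    then show ?thesis
      by (simp add: coeff_T_multiplier[OF N j] coeff_T_cscale)
  qed (simp add: coeff_T_multiplier[OF N j] coeff_T_cscale coeff_T_T_mat_other)
qed

text \<open>An even real symbol respects the reality condition \<open>cnj_coeff_T\<close>, which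
  exchanges j and -j.\<close>

lemma su_multiplier:
  assumes N: "odd CARD('n)" and f: "\<And>k. k \<in> Z_N CARD('n) \<Longrightarrow> f (- k) = f k"
    and u: "u \<in> su"
  shows "multiplier f (u :: 'n::{finite,linorder} cmat) \<in> su"
proof -
  have "dagger (multiplier f u) =
      (\<Sum>j\<in>Z_N CARD('n). - cscale (of_real (f (- j)) * coeff_T (- j) u) (T_mat (- j)))"
    unfolding multiplier_def dagger_sum
    by (intro sum.cong refl) (simp add: dagger_cscale dagger_T_mat cnj_coeff_T[OF u] f vec_eq_iff)
  also have "\<dots> = - multiplier f u"
    unfolding multiplier_def sum_negf
    by (subst sum_Z_N_minus[OF N, where f = "\<lambda>j. cscale (of_real (f j) * coeff_T j u) (T_mat j)"]) simp
  finally show ?thesis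
    by (simp add: su_def trace_multiplier[OF N])
qed

section \<open>The real basis\<close>

lemma X_mat_eq: "X_mat k = cscale (1/2) (T_mat k + T_mat (- k))"
  by (simp add: X_mat_def mat_mult_eq_cscale)

lemma Y_mat_eq: "Y_mat k = cscale (- (\<i> / 2)) (T_mat k - T_mat (- k))"
proof -
  have "1 / (2 * \<i>) = - (\<i> / 2)"
    by (simp add: complex_eq_iff Re_divide Im_divide)
  then show ?thesis
    by (simp only: Y_mat_def mat_mult_eq_cscale)
qed

lemma T_mat_eq_X_Y: "T_mat (- k) = X_mat k - cscale \<i> (Y_mat k)"
  by (simp add: X_mat_eq Y_mat_eq vec_eq_iff) (simp add: field_simps)

lemma su_X_mat:
  assumes "odd CARD('n)" "k \<in> Z_N CARD('n)"
  shows "X_mat k \<in> (su :: 'n::{finite,linorder} cmat set)"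
  using assms
  by (simp add: su_def X_mat_eq dagger_cscale dagger_add dagger_T_mat trace_cscale trace_add
      trace_T_mat Z_N_not_null) (simp add: vec_eq_iff field_simps)

lemma su_Y_mat:
  assumes "odd CARD('n)" "k \<in> Z_N CARD('n)"
  shows "Y_mat k \<in> (su :: 'n::{finite,linorder} cmat set)"
  using assms
  by (simp add: su_def Y_mat_eq dagger_cscale dagger_diff dagger_T_mat trace_cscale trace_sub
      trace_T_mat Z_N_not_null) (simp add: vec_eq_iff field_simps)

lemma coeff_T_T_mat_Z_N:
  assumes N: "odd CARD('n)" and "k \<in> Z_N CARD('n)" "j \<in> Z_N CARD('n)"
  shows "coeff_T j (T_mat k :: 'n::{finite,linorder} cmat) = (if j = k then 1 else 0)"
proof (cases "j = k")
  case False
  then have "\<not> null_mod CARD('n) (k - j)"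
    using Z_N_unique[OF assms] by blast
  then show ?thesis
    using False by (simp add: coeff_T_T_mat_other)
qed (simp add: coeff_T_T_mat_self)

section \<open>Zeitlin's metric\<close>

lemma multiplier_diff: "multiplier f (u - v) = multiplier f u - multiplier f v"
  using multiplier_add[of f "u - v" v] by (simp add: algebra_simps)

text \<open>Invariance of the trace form under the adjoint action, by cyclicity of the
  trace.\<close>

lemma trace_commutator_mult:
  "trace (commutator B C ** D) = trace (C ** commutator D (B :: 'n::finite cmat))"
proof -
  have "trace ((B ** C) ** D) = trace (C ** (D ** B))"
    by (metis trace_mul_sym matrix_mul_assoc)
  then show ?thesis
    by (simp add: commutator_def matrix_distribs trace_sub matrix_mul_assoc)
qed

lemma X_mat_minus: "X_mat (- k) = X_mat k"
  by (simp add: X_mat_eq add.commute)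

text \<open>The difference is rewritten as a sum so that additivity and homogeneity of
  \<open>curv\<close> and \<open>ric\<close> suffice for expansion.\<close>

lemma Y_mat_eq': "Y_mat k = cscale (- (\<i> / 2)) (T_mat k + cscale (- 1) (T_mat (- k)))"
  by (simp add: Y_mat_eq vec_eq_iff)

lemma coeff_T_X_mat:
  assumes N: "odd CARD('n)" and k: "k \<in> Z_N CARD('n)"
  shows "coeff_T k (X_mat k :: 'n::{finite,linorder} cmat) = 1 / 2"
    "coeff_T (- k) (X_mat k :: 'n cmat) = 1 / 2"
  using minus_in_Z_N[OF N k] k minus_neq_in_Z_N[OF N k]
  by (simp_all add: X_mat_eq coeff_T_cscale coeff_T_add coeff_T_T_mat_Z_N[OF N])

lemma coeff_T_Y_mat:
  assumes N: "odd CARD('n)" and k: "k \<in> Z_N CARD('n)"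
  shows "coeff_T k (Y_mat k :: 'n::{finite,linorder} cmat) = - (\<i> / 2)"
    "coeff_T (- k) (Y_mat k :: 'n cmat) = \<i> / 2"
  using minus_in_Z_N[OF N k] k minus_neq_in_Z_N[OF N k]
  by (simp_all add: Y_mat_eq coeff_T_cscale coeff_T_diff coeff_T_T_mat_Z_N[OF N])

lemma trace_X_mat_mult:
  "trace (X_mat k ** u) =
    of_real (trace_norm CARD('n) / 2) * (coeff_T k u + coeff_T (- k) (u :: 'n::{finite,linorder} cmat))"
  by (simp add: X_mat_eq cscale_mult_left trace_cscale matrix_add_rdistrib trace_add trace_T_mat_mult
      algebra_simps)

lemma trace_Y_mat_mult:
  "trace (Y_mat k ** u) = of_real (trace_norm CARD('n) / 2) *
    (\<i> * (coeff_T k u - coeff_T (- k) (u :: 'n::{finite,linorder} cmat)))"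
  by (simp add: Y_mat_eq cscale_mult_left trace_cscale matrix_diff_rdistrib trace_sub trace_T_mat_mult
      algebra_simps)

section \<open>Spectrum of L, its identification with a multiplier, and the inner product\<close>

locale zeitlin =
  fixes L :: "'n::{finite,linorder} cmat \<Rightarrow> 'n cmat" and lam :: "int \<times> int \<Rightarrow> real"
  assumes odd_card: "odd CARD('n)" and zeitlin_operator: "zeitlin_operator L lam"
begin

lemmas zeitlin_operator_unfolded = zeitlin_operator[unfolded zeitlin_operator_def]

lemma L_bij: "bij_betw L su su"
  by (rule zeitlin_operator_unfolded[THEN conjunct1])

lemma L_su: "u \<in> su \<Longrightarrow> L u \<in> su"
  using bij_betw_apply[OF L_bij] .

lemma L_surj: "u \<in> su \<Longrightarrow> \<exists>v\<in>su. L v = u"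
  using L_bij unfolding bij_betw_def by (metis imageE)

lemma L_selfadjoint: "u \<in> su \<Longrightarrow> v \<in> su \<Longrightarrow> trace (dagger u ** L v) = trace (dagger (L u) ** v)"
  by (rule zeitlin_operator_unfolded[THEN conjunct2, THEN conjunct2, THEN conjunct2, THEN conjunct1,
      rule_format])

lemma L_eigenvalue_neg: "v \<in> su \<Longrightarrow> v \<noteq> 0 \<Longrightarrow> L v = c *\<^sub>R v \<Longrightarrow> c < 0"
  by (rule zeitlin_operator_unfolded[THEN conjunct2, THEN conjunct2, THEN conjunct2, THEN conjunct2,
      THEN conjunct1, rule_format])

lemma L_basis:
  assumes "k \<in> Z_N CARD('n)"
  shows L_X_mat: "L (X_mat k) = lam k *\<^sub>R X_mat k" and L_Y_mat: "L (Y_mat k) = lam k *\<^sub>R Y_mat k"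
  using zeitlin_operator_unfolded[THEN conjunct2, THEN conjunct2, THEN conjunct2, THEN conjunct2,
      THEN conjunct2, rule_format, OF assms] by simp_all

lemma X_mat_neq_0:
  assumes "k \<in> Z_N CARD('n)"
  shows "X_mat k \<noteq> (0 :: 'n cmat)"
proof
  assume "X_mat k = (0 :: 'n cmat)"
  then have "coeff_T k (0 :: 'n cmat) = 1 / 2"
    using coeff_T_X_mat(1)[OF odd_card assms] by simp
  then show False
    using coeff_T_diff[of k "0 :: 'n cmat" 0] by simp
qed

text \<open>X_k and X_(-k) are the same nonzero vector, so their eigenvalues agree.\<close>

lemma lam_minus:
  assumes k: "k \<in> Z_N CARD('n)"
  shows "lam (- k) = lam k"
proof -
  have "lam k *\<^sub>R X_mat k = lam (- k) *\<^sub>R (X_mat k :: 'n cmat)"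
    using L_X_mat[OF k] L_X_mat[OF minus_in_Z_N[OF odd_card k]] by (simp add: X_mat_minus)
  then show ?thesis
    using X_mat_neq_0[OF k] by simp
qed

lemma lam_neg: "k \<in> Z_N CARD('n) \<Longrightarrow> lam k < 0"
  by (rule L_eigenvalue_neg[OF su_X_mat[OF odd_card] X_mat_neq_0 L_X_mat])

text \<open>L u and the Fourier multiplier have the same coefficients since L is self-adjoint and the
  X k, Y k are eigenvectors.\<close>

lemma L_eq_multiplier:
  assumes u: "u \<in> su"
  shows "L u = multiplier lam u"
proof (rule eq_if_coeff_T_eq[OF odd_card])
  show "trace (L u) = trace (multiplier lam u)"
    using L_su[OF u] by (simp add: su_def trace_multiplier[OF odd_card])
  fix k assume k: "k \<in> Z_N CARD('n)"
  have *: "trace (B ** L u) = of_real (lam k) * trace (B ** u)"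
    if "B \<in> su" "L B = lam k *\<^sub>R B" for B
    using L_selfadjoint[OF that(1) u] that su_dagger[OF that(1)]
    by (simp add: dagger_scaleR matrix_minus_left matrix_scaleR_left trace_minus trace_scaleR)
  have "trace (T_mat (- k) ** L u) = of_real (lam k) * trace (T_mat (- k) ** u)"
    unfolding T_mat_eq_X_Y
    using *[OF su_X_mat[OF odd_card k] L_X_mat[OF k]] *[OF su_Y_mat[OF odd_card k] L_Y_mat[OF k]]
    by (simp add: matrix_diff_rdistrib trace_sub cscale_mult_left trace_cscale right_diff_distrib
        mult.left_commute)
  then have "coeff_T k (L u) = of_real (lam k) * coeff_T k u"
    by (simp add: coeff_T_def)
  then show "coeff_T k (L u) = coeff_T k (multiplier lam u)"
    by (simp add: coeff_T_multiplier[OF odd_card k])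
qed

lemma su_multiplier_lam:
  assumes "u \<in> (su :: 'n cmat set)"
  shows "multiplier lam u \<in> su" "multiplier (\<lambda>j. inverse (lam j)) u \<in> su"
  using assms by (simp_all add: su_multiplier[OF odd_card] lam_minus)

lemma multiplier_lam_inverse:
  assumes "u \<in> (su :: 'n cmat set)"
  shows "multiplier lam (multiplier (\<lambda>j. inverse (lam j)) u) = u"
proof (rule eq_if_coeff_T_eq[OF odd_card])
  show "trace (multiplier lam (multiplier (\<lambda>j. inverse (lam j)) u)) = trace u"
    using assms by (simp add: su_def trace_multiplier[OF odd_card])
  fix k assume k: "k \<in> Z_N CARD('n)"
  show "coeff_T k (multiplier lam (multiplier (\<lambda>j. inverse (lam j)) u)) = coeff_T k u"
    using lam_neg[OF k] by (simp add: coeff_T_multiplier[OF odd_card k])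
qed

definition hbar :: real where
  "hbar = 2 ^ 4 * pi ^ 4 / real CARD('n) ^ 3"

lemma hbar_pos: "hbar > 0"
  by (simp add: hbar_def)

lemma inner_eq:
  assumes "u \<in> su"
  shows "zeitlin_inner L u v = hbar * Re (trace (u ** L v))"
  by (simp add: zeitlin_inner_def hbar_def su_dagger[OF assms] matrix_minus_left trace_minus)

lemma inner_sym:
  assumes "u \<in> su" "v \<in> su"
  shows "zeitlin_inner L u v = zeitlin_inner L v u"
proof -
  have "trace (dagger u ** L v) = cnj (trace (dagger v ** L u))"
    using L_selfadjoint[OF assms] by (simp add: dagger_mult flip: trace_dagger)
  then show ?thesis by (simp add: zeitlin_inner_def)
qed

lemma inner_diff_left: "zeitlin_inner L (u - u') v = zeitlin_inner L u v - zeitlin_inner L u' v"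
  by (simp add: zeitlin_inner_def dagger_diff matrix_diff_rdistrib trace_sub algebra_simps
      diff_divide_distrib)

text \<open>Surjectivity of L provides the test vector w with L w = u - v, which turns the pairing
  of u - v with w into a nonzero multiple of the squared norm of u - v.\<close>

lemma inner_nondegenerate:
  assumes u: "u \<in> su" and v: "v \<in> su"
    and eq: "\<And>w. w \<in> su \<Longrightarrow> zeitlin_inner L u w = zeitlin_inner L v w"
  shows "u = v"
proof -
  obtain w where w: "w \<in> su" "L w = u - v"
    using L_surj[OF su_diff[OF u v]] by blast
  have "zeitlin_inner L (u - v) w = 0"
    using eq[OF w(1)] by (simp add: inner_diff_left)
  then have "(norm (u - v))\<^sup>2 = 0"
    using hbar_pos by (simp add: zeitlin_inner_def w(2) Re_trace_dagger_self)
  then show ?thesis by simp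
qed

section \<open>Koszul's formula on the Lie algebra\<close>

definition conn :: "'n cmat \<Rightarrow> 'n cmat \<Rightarrow> 'n cmat" where
  "conn A B = cscale (1/2) (commutator A B + multiplier (\<lambda>j. inverse (lam j))
     (commutator A (multiplier lam B) - commutator (multiplier lam A) B))"

definition curv :: "'n cmat \<Rightarrow> 'n cmat \<Rightarrow> 'n cmat \<Rightarrow> 'n cmat" where
  "curv A B C = conn A (conn B C) - conn B (conn A C) - conn (commutator A B) C"

lemma conn_su:
  assumes "A \<in> su" "B \<in> su"
  shows "conn A B \<in> su"
proof -
  have "conn A B = (1/2) *\<^sub>R (commutator A B + multiplier (\<lambda>j. inverse (lam j))
     (commutator A (multiplier lam B) - commutator (multiplier lam A) B))"
    unfolding conn_def cscale_of_real[symmetric] by simp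
  then show ?thesis
    using assms by (simp add: su_scaleR su_add su_diff su_commutator su_multiplier_lam)
qed

text \<open>Pairing with C applies the multiplier of \<open>lam\<close>, which cancels the inverse
  multiplier in \<open>conn\<close>; invariance of the trace form then moves A and B out of the
  remaining brackets.\<close>

lemma inner_conn:
  assumes A: "A \<in> su" and B: "B \<in> su" and C: "C \<in> su"
  shows "2 * zeitlin_inner L (conn A B) C = zeitlin_inner L (commutator A B) C
    - zeitlin_inner L (commutator B C) A + zeitlin_inner L (commutator C A) B"
proof -
  let ?M = "multiplier lam :: 'n cmat \<Rightarrow> 'n cmat"
  have AB: "commutator A (?M B) - commutator (?M A) B \<in> su"
    using A B by (simp add: su_diff su_commutator su_multiplier_lam)
  have "?M (conn A B) = cscale (1/2)
      (?M (commutator A B) + (commutator A (?M B) - commutator (?M A) B))"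
    by (simp add: conn_def multiplier_cscale multiplier_add multiplier_lam_inverse[OF AB])
  then have "2 * trace (C ** ?M (conn A B)) = trace (C ** ?M (commutator A B))
      + trace (C ** commutator A (?M B)) - trace (C ** commutator (?M A) B)"
    by (simp add: cscale_mult_right trace_cscale matrix_distribs trace_add trace_sub)
  also have "trace (C ** commutator A (?M B)) = trace (commutator C A ** ?M B)"
    using trace_commutator_mult[of A C "?M B"]
    by (simp add: commutator_def matrix_distribs trace_sub) (metis minus_diff_eq)
  also have "trace (C ** commutator (?M A) B) = trace (commutator B C ** ?M A)"
    by (rule trace_commutator_mult[symmetric])
  finally have "2 * Re (trace (C ** ?M (conn A B))) = Re (trace (C ** ?M (commutator A B))
      + trace (commutator C A ** ?M B) - trace (commutator B C ** ?M A))"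
    by (metis Re_complex_of_real mult_2 plus_complex.sel(1))
  then have "2 * (hbar * Re (trace (C ** ?M (conn A B)))) = hbar * Re (trace (C ** ?M (commutator A B)))
      + hbar * Re (trace (commutator C A ** ?M B)) - hbar * Re (trace (commutator B C ** ?M A))"
    by (simp add: algebra_simps) (simp flip: distrib_left right_diff_distrib)
  moreover have "zeitlin_inner L X C = hbar * Re (trace (C ** ?M X))" if "X \<in> su" for X
    unfolding inner_sym[OF that C] inner_eq[OF C] L_eq_multiplier[OF that] ..
  ultimately show ?thesis
    using A B C by (simp add: conn_su su_commutator inner_eq[of "commutator _ _"] L_eq_multiplier)
qed

section \<open>The connection on left-invariant fields\<close>

context
  fixes nab :: "'n vfield \<Rightarrow> 'n vfield \<Rightarrow> 'n vfield"
  assumes LC: "levi_civita (zeitlin_metric L) nab"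
begin

lemma nab_affine: "affine_connection nab"
  using LC by (simp add: levi_civita_def)

lemma nab_tangent:
  assumes "A \<in> su" "B \<in> su" "g \<in> SU"
  shows "\<exists>W\<in>su. nab (left_inv A) (left_inv B) g = g ** W"
proof -
  have "smooth_vfield (nab (left_inv A) (left_inv B))"
    using nab_affine[unfolded affine_connection_def, THEN conjunct1] assms smooth_vfield_left_inv
    by blast
  then show ?thesis
    using assms(3) by (auto simp: smooth_vfield_def tangent_SU_def)
qed

text \<open>With g fixed, W is the connection pulled back to the Lie algebra, a priori depending on
  g. Metric compatibility and vanishing torsion determine it through \<open>inner_conn\<close>, so
  it is the same at every g.\<close>

lemma nab_left_inv:
  assumes A: "A \<in> su" and B: "B \<in> su" and g: "g \<in> SU"
  shows "nab (left_inv A) (left_inv B) g = left_inv (conn A B) g"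
proof -
  define W where "W A B = dagger g ** nab (left_inv A) (left_inv B) g" for A B
  have cancel: "dagger g ** (g ** X) = X" for X
    using SU_dagger[OF g] by (simp add: matrix_mul_assoc)
  have W: "W A B \<in> su" "nab (left_inv A) (left_inv B) g = g ** W A B"
    if "A \<in> su" "B \<in> su" for A B
    using nab_tangent[OF that g] by (auto simp: W_def cancel)
  \<comment> \<open>The metric of two left-invariant fields is constant on \<open>SU\<close>, so its
    derivative vanishes and W A is skew for the inner product.\<close>
  have compat: "zeitlin_inner L (W A B) C + zeitlin_inner L B (W A C) = 0"
    if "A \<in> su" "B \<in> su" "C \<in> su" for A B C
  proof -
    have "dir_deriv (\<lambda>h. zeitlin_metric L h (left_inv B h) (left_inv C h)) g (left_inv A g) =
        zeitlin_metric L g (nab (left_inv A) (left_inv B) g) (left_inv C g) +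
        zeitlin_metric L g (left_inv B g) (nab (left_inv A) (left_inv C) g)"
      using LC[unfolded levi_civita_def, THEN conjunct2, THEN conjunct2, rule_format,
          OF smooth_vfield_left_inv smooth_vfield_left_inv smooth_vfield_left_inv g] that
      by blast
    also have "\<dots> = zeitlin_inner L (W A B) C + zeitlin_inner L B (W A C)"
      by (simp add: zeitlin_metric_def left_inv_apply cancel W_def)
    also have "dir_deriv (\<lambda>h. zeitlin_metric L h (left_inv B h) (left_inv C h)) g (left_inv A g) = 0"
      unfolding left_inv_apply
    proof (rule dir_deriv_const[OF _ g that(1)])
      fix h :: "'n cmat" assume "h \<in> SU"
      then show "zeitlin_metric L h (h ** B) (h ** C) = zeitlin_inner L B C"
        using SU_dagger[of h] by (simp add: zeitlin_metric_def matrix_mul_assoc)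
    qed
    finally show ?thesis by simp
  qed
  have torsion: "W A B - W B A = commutator A B" if "A \<in> su" "B \<in> su" for A B
  proof -
    have "nab (left_inv A) (left_inv B) g - nab (left_inv B) (left_inv A) g =
        lie_bracket (left_inv A) (left_inv B) g"
      using LC[unfolded levi_civita_def, THEN conjunct2, THEN conjunct1, rule_format,
          OF smooth_vfield_left_inv smooth_vfield_left_inv g] that by blast
    also have "\<dots> = g ** commutator A B"
      using lie_bracket_left_inv[OF that g] by (simp add: left_inv_apply)
    finally show ?thesis
      by (simp add: W_def cancel flip: matrix_diff_ldistrib)
  qed
  have "W A B = conn A B"
  proof (rule inner_nondegenerate[OF W(1)[OF A B] conn_su[OF A B]])
    fix C :: "'n cmat" assume C: "C \<in> su"
    \<comment> \<open>Torsion rewrites the three brackets as six terms in W; by skewness four of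
      them cancel and the other two both equal the pairing of W A B with C.\<close>
    have sk: "zeitlin_inner L (W X Y) Z = - zeitlin_inner L (W X Z) Y"
      if "X \<in> su" "Y \<in> su" "Z \<in> su" for X Y Z
      using compat[OF that] inner_sym[OF that(2) W(1)[OF that(1,3)]] by simp
    have "zeitlin_inner L (commutator A B) C = zeitlin_inner L (W A B) C - zeitlin_inner L (W B A) C"
      "zeitlin_inner L (commutator B C) A = zeitlin_inner L (W B C) A - zeitlin_inner L (W C B) A"
      "zeitlin_inner L (commutator C A) B = zeitlin_inner L (W C A) B - zeitlin_inner L (W A C) B"
      using A B C by (simp_all add: inner_diff_left flip: torsion)
    with inner_conn[OF A B C] sk[OF B A C] sk[OF C A B] sk[OF A B C]
    show "zeitlin_inner L (W A B) C = zeitlin_inner L (conn A B) C"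
      by simp
  qed
  then show ?thesis
    using W(2)[OF A B] by (simp add: left_inv_apply)
qed

end

lemma curvature_su_eq_curv:
  assumes "levi_civita (zeitlin_metric L) nab" "A \<in> su" "B \<in> su" "C \<in> su"
  shows "curvature_su nab A B C = curv A B C"
  unfolding curv_def
  by (rule curvature_su_eq[OF nab_affine[OF assms(1)] nab_left_inv[OF assms(1)] conn_su assms(2-4)])

lemma curv_su: "A \<in> su \<Longrightarrow> B \<in> su \<Longrightarrow> C \<in> su \<Longrightarrow> curv A B C \<in> su"
  by (simp add: curv_def su_diff conn_su su_commutator)

section \<open>Complex multilinearity\<close>

lemma conn_add: "conn (A + B) C = conn A C + conn B C" "conn A (B + C) = conn A B + conn A C"
  by (simp_all add: conn_def commutator_add multiplier_add multiplier_diff cscale_add cscale_diff)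

lemma conn_cscale: "conn (cscale z A) B = cscale z (conn A B)" "conn A (cscale z B) = cscale z (conn A B)"
  by (simp_all add: conn_def commutator_cscale multiplier_cscale multiplier_diff cscale_add cscale_diff
      mult.commute)

lemma curv_add:
  "curv (A + A') B C = curv A B C + curv A' B C"
  "curv A (B + B') C = curv A B C + curv A B' C"
  "curv A B (C + C') = curv A B C + curv A B C'"
  by (simp_all add: curv_def conn_add commutator_add)

lemma curv_cscale:
  "curv (cscale z A) B C = cscale z (curv A B C)"
  "curv A (cscale z B) C = cscale z (curv A B C)"
  "curv A B (cscale z C) = cscale z (curv A B C)"
  by (simp_all add: curv_def conn_cscale commutator_cscale cscale_diff)

section \<open>Connection, curvature and Ricci coefficients on the matrices T\<close>

definition eig :: "int \<times> int \<Rightarrow> real" where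
  "eig = extend_mod CARD('n) lam"

text \<open>The 1 comes from the bracket in \<open>conn\<close>, the other summand from its metric
  correction, which disappears for equal eigenvalues.\<close>

definition conn_coeff :: "int \<times> int \<Rightarrow> int \<times> int \<Rightarrow> real" where
  "conn_coeff k l = struct_const CARD('n) k l / 2 * (1 + (eig l - eig k) * inverse (eig (k + l)))"

lemma conn_T_mat: "conn (T_mat k) (T_mat l) = cscale (of_real (conn_coeff k l)) (T_mat (k + l))"
  by (simp add: conn_def commutator_T_mat multiplier_T_mat[OF odd_card] commutator_cscale
      multiplier_cscale multiplier_diff extend_mod_inverse conn_coeff_def eig_def
      flip: cscale_add_left cscale_diff_left)
    (simp add: algebra_simps)

definition curv_coeff :: "int \<times> int \<Rightarrow> int \<times> int \<Rightarrow> int \<times> int \<Rightarrow> real" where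
  "curv_coeff i k l = conn_coeff k l * conn_coeff i (k + l) - conn_coeff i l * conn_coeff k (i + l)
     - struct_const CARD('n) i k * conn_coeff (i + k) l"

lemma curv_T_mat:
  "curv (T_mat i) (T_mat k) (T_mat l) = cscale (of_real (curv_coeff i k l)) (T_mat (i + (k + l)))"
  by (simp add: curv_def curv_coeff_def conn_T_mat conn_cscale commutator_T_mat add.assoc
      add.left_commute[of k i] cscale_diff_left)

text \<open>Without the index 0 this is the trace over the complexification of \<open>su\<close>,
  not over all matrices; it is complex bilinear in E and F.\<close>

definition ric :: "'n cmat \<Rightarrow> 'n cmat \<Rightarrow> complex" where
  "ric E F = (\<Sum>i\<in>Z_N CARD('n). coeff_T i (curv (T_mat i) E F))"

lemma ric_add: "ric (E + E') F = ric E F + ric E' F" "ric E (F + F') = ric E F + ric E F'"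
  by (simp_all add: ric_def curv_add coeff_T_add sum.distrib)

lemma ric_cscale: "ric (cscale z E) F = z * ric E F" "ric E (cscale z F) = z * ric E F"
  by (simp_all add: ric_def curv_cscale coeff_T_cscale sum_distrib_left)

text \<open>\<open>curv\<close> is graded by the index: T_i is sent to a multiple of T_(i + k + l),
  which contributes to the diagonal only if k + l is in the zero class.\<close>

lemma ric_T_mat_0:
  assumes "\<not> null_mod CARD('n) (k + l)"
  shows "ric (T_mat k) (T_mat l) = 0"
  unfolding ric_def curv_T_mat coeff_T_cscale
  by (rule sum.neutral) (simp add: coeff_T_T_mat_other assms)

lemma ric_T_mat:
  "ric (T_mat k) (T_mat (- k)) = of_real (\<Sum>i\<in>Z_N CARD('n). curv_coeff i k (- k))"
  by (simp add: ric_def curv_T_mat coeff_T_cscale coeff_T_T_mat_self)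

text \<open>The Ricci form is the trace of a linear map, which may be computed in the complex basis T i
  instead of X i, Y i.\<close>

lemma Ric_N_eq_ric:
  assumes LC: "levi_civita (zeitlin_metric L) nab" and E: "E \<in> su" and F: "F \<in> su"
  shows "Ric_N L nab E F = 1 / (real CARD('n) ^ 2 - 1) * Re (ric E F)"
proof -
  define R where "R i = curv (T_mat i) E F" for i
  have tn: "trace_norm CARD('n) \<noteq> 0"
    by (simp add: trace_norm_neq_0)
  \<comment> \<open>B is an eigenvector of L, so numerator and denominator share the factor
    \<open>hbar * lam i\<close> and the quotient depends only on the trace form.\<close>
  have ratio: "zeitlin_inner L u B / zeitlin_inner L B B = Re (trace (B ** u)) / Re (trace (B ** B))"
    if "u \<in> su" "B \<in> su" "L B = lam i *\<^sub>R B" "i \<in> Z_N CARD('n)" for u B i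
    using that hbar_pos lam_neg[OF that(4)]
    by (simp add: inner_eq matrix_scaleR_right trace_scaleR trace_mul_sym[of u])
  have "zeitlin_inner L (curvature_su nab (X_mat i) E F) (X_mat i) / zeitlin_inner L (X_mat i) (X_mat i) +
      zeitlin_inner L (curvature_su nab (Y_mat i) E F) (Y_mat i) / zeitlin_inner L (Y_mat i) (Y_mat i) =
      Re (coeff_T i (R i) + coeff_T (- i) (R (- i)))" if "i \<in> Z_N_plus CARD('n)" for i
  proof -
    have i: "i \<in> Z_N CARD('n)"
      using that Z_N_plus_subset by blast
    note X = su_X_mat[OF odd_card i] and Y = su_Y_mat[OF odd_card i]
    have cX: "curv (X_mat i) E F = cscale (1/2) (R i + R (- i))"
      by (simp add: X_mat_eq curv_add curv_cscale R_def)
    have cY: "curv (Y_mat i) E F = cscale (- (\<i> / 2)) (R i + cscale (- 1) (R (- i)))"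
      unfolding Y_mat_eq' by (simp add: curv_add curv_cscale R_def del: cscale_cscale)
    have "trace (X_mat i ** X_mat i :: 'n cmat) = of_real (trace_norm CARD('n) / 2)"
      by (simp add: trace_X_mat_mult coeff_T_X_mat[OF odd_card i])
    then have rX: "Re (trace (X_mat i ** u)) / Re (trace (X_mat i ** X_mat i :: 'n cmat)) =
        Re (coeff_T i u + coeff_T (- i) u)" for u :: "'n cmat"
      using tn by (simp add: trace_X_mat_mult)
    have "\<i> * (- (\<i> / 2) - \<i> / 2) = 1"
      by (simp add: complex_eq_iff)
    then have "trace (Y_mat i ** Y_mat i :: 'n cmat) = of_real (trace_norm CARD('n) / 2)"
      unfolding trace_Y_mat_mult coeff_T_Y_mat[OF odd_card i] by simp
    then have rY: "Re (trace (Y_mat i ** u)) / Re (trace (Y_mat i ** Y_mat i :: 'n cmat)) =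
        Re (\<i> * (coeff_T i u - coeff_T (- i) u))" for u :: "'n cmat"
      using tn by (simp add: trace_Y_mat_mult)
    have "zeitlin_inner L (curvature_su nab (X_mat i) E F) (X_mat i) / zeitlin_inner L (X_mat i) (X_mat i)
        = Re (coeff_T i (curv (X_mat i) E F) + coeff_T (- i) (curv (X_mat i) E F))"
      unfolding curvature_su_eq_curv[OF LC X E F]
      by (simp only: ratio[OF curv_su[OF X E F] X L_X_mat[OF i] i] rX)
    moreover have "zeitlin_inner L (curvature_su nab (Y_mat i) E F) (Y_mat i) / zeitlin_inner L (Y_mat i) (Y_mat i)
        = Re (\<i> * (coeff_T i (curv (Y_mat i) E F) - coeff_T (- i) (curv (Y_mat i) E F)))"
      unfolding curvature_su_eq_curv[OF LC Y E F]
      by (simp only: ratio[OF curv_su[OF Y E F] Y L_Y_mat[OF i] i] rY)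
    \<comment> \<open>The coefficients of R i at -i and of R (-i) at i occur with opposite signs in
      the X and Y parts and cancel.\<close>
    ultimately show ?thesis
      unfolding cX cY coeff_T_cscale coeff_T_add by (simp add: field_simps)
  qed
  then have "Ric_N L nab E F = 1 / (real CARD('n) ^ 2 - 1) *
      (\<Sum>i\<in>Z_N_plus CARD('n). Re (coeff_T i (R i) + coeff_T (- i) (R (- i))))"
    by (simp add: Ric_N_def)
  also have "(\<Sum>i\<in>Z_N_plus CARD('n). Re (coeff_T i (R i) + coeff_T (- i) (R (- i)))) = Re (ric E F)"
    by (simp only: ric_def R_def sum_Z_N[OF odd_card] Re_sum)
  finally show ?thesis .
qed

section \<open>Evaluation\<close>

definition ric_term :: "int \<times> int \<Rightarrow> int \<times> int \<Rightarrow> real" where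
  "ric_term k i = (struct_const CARD('n) k i)\<^sup>2 *
     ((- 3 * (eig (k + i) + eig (k - i))
       + (eig i - eig k)\<^sup>2 * (inverse (eig (k + i)) + inverse (eig (k - i)))
       + 4 * (eig k + eig i)) / (8 * eig i))"

lemma eig_minus: "eig (- k) = eig k"
  unfolding eig_def by (rule extend_mod_minus[OF odd_card]) (rule lam_minus)

lemma eig_minus_diff: "eig (i - k) = eig (k - i)"
  using eig_minus[of "k - i"] by simp

lemma eig_neq_0: "\<not> null_mod CARD('n) k \<Longrightarrow> eig k \<noteq> 0"
  using lam_neg[OF red_in_Z_N[OF odd_card], of k] by (simp add: eig_def extend_mod_def)

lemma struct_const_cong: "cross2 k l = cross2 k' l' \<Longrightarrow> struct_const N k l = struct_const N k' l'"
  by (simp add: struct_const_def)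

lemma struct_const_minus: "cross2 k l = - cross2 k' l' \<Longrightarrow> struct_const N k l = - struct_const N k' l'"
  by (simp add: struct_const_def)

lemma struct_const_eq_0:
  assumes "int CARD('n) dvd cross2 k l"
  shows "struct_const CARD('n) k l = 0"
proof -
  obtain m where "cross2 k l = int CARD('n) * m"
    using assms by (auto elim: dvdE)
  then have "pi / real CARD('n) * real_of_int (cross2 k l) = pi * real_of_int m"
    by simp
  then show ?thesis
    by (simp add: struct_const_def sin_zero_iff_int2 mult.commute)
qed

text \<open>Since i x i = 0, k x i equals (k + i) x i and (k - i) x i. A nonzero sine thus
  guarantees that the shifted eigenvalues are genuine ones.\<close>

lemma not_null_mod_if_cross2:
  assumes "\<not> int N dvd cross2 k i"
  shows "\<not> null_mod N (k + i)" "\<not> null_mod N (k - i)"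
proof -
  have "cross2 k i = fst (k + i) * snd i - snd (k + i) * fst i"
    "cross2 k i = fst (k - i) * snd i - snd (k - i) * fst i"
    by (simp_all add: cross2_def algebra_simps)
  then show "\<not> null_mod N (k + i)" "\<not> null_mod N (k - i)"
    using assms unfolding null_mod_def by (metis dvd_diff dvd_mult2)+
qed

text \<open>For l = -k the first product in \<open>curv_coeff\<close> contains
  \<open>conn_coeff i 0\<close>, which vanishes; in the others every structure constant is x or -x
  because the cross product is bilinear and alternating.\<close>

lemma curv_coeff_eq:
  fixes i k :: "int \<times> int"
  defines "x \<equiv> struct_const CARD('n) k i"
  shows "curv_coeff i k (- k) =
    - (x / 2 * (1 + (eig k - eig i) * inverse (eig (k - i)))) *
      (x / 2 * (1 + (eig (k - i) - eig k) * inverse (eig i))) +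
    x * (x / 2 * (1 + (eig k - eig (k + i)) * inverse (eig i)))"
proof -
  have "struct_const CARD('n) i (- k) = x" "struct_const CARD('n) k (i + - k) = x"
    "struct_const CARD('n) (i + k) (- k) = x"
    unfolding x_def by (rule struct_const_cong, simp add: cross2_def algebra_simps)+
  moreover have "struct_const CARD('n) i k = - x"
    unfolding x_def by (rule struct_const_minus) (simp add: cross2_def algebra_simps)
  moreover have "struct_const CARD('n) i 0 = 0"
    by (simp add: struct_const_def cross2_def)
  ultimately show ?thesis
    by (simp add: curv_coeff_def conn_coeff_def eig_minus eig_minus_diff add.commute[of i k])
qed

text \<open>One coefficient treats k + i and k - i differently; passing to -i exchanges them and
  flips the sign of x, which enters only squared.\<close>

lemma curv_coeff_pair:
  assumes i: "i \<in> Z_N CARD('n)"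
  shows "curv_coeff i k (- k) + curv_coeff (- i) k (- k) = 2 * ric_term k i"
proof -
  define x where "x = struct_const CARD('n) k i"
  have x': "struct_const CARD('n) k (- i) = - x"
    unfolding x_def by (rule struct_const_minus) (simp add: cross2_def)
  show ?thesis
  proof (cases "x = 0")
    case True
    then show ?thesis
      using x' by (simp add: curv_coeff_eq[of i] curv_coeff_eq[of "- i"] ric_term_def x_def)
  next
    case False
    have nd: "\<not> int CARD('n) dvd cross2 k i"
      using False struct_const_eq_0 unfolding x_def by blast
    have nz: "eig (k + i) \<noteq> 0" "eig (k - i) \<noteq> 0" "eig i \<noteq> 0"
      using not_null_mod_if_cross2[OF nd] Z_N_not_null[OF odd_card i] by (simp_all add: eig_neq_0)
    define a b p q where "a = eig (k + i)" and "b = eig (k - i)" and "p = eig i" and "q = eig k"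
    \<comment> \<open>The product of connection coefficients is a difference of squares,
      contributing -(a + b) and the quotients of (p - q)^2; the bracket terms contribute -2 (a + b)
      + 4 (p + q). The total carries the factor x^2 / (4 p), whence -3, 4 and the 8 on
      halving.\<close>
    have alg: "- (x / 2 * (1 + (q - p) * inverse b)) * (x / 2 * (1 + (b - q) * inverse p)) +
        x * (x / 2 * (1 + (q - a) * inverse p)) +
        (- (- x / 2 * (1 + (q - p) * inverse a)) * (- x / 2 * (1 + (a - q) * inverse p)) +
        - x * (- x / 2 * (1 + (q - b) * inverse p))) =
        2 * (x\<^sup>2 * ((- 3 * (a + b) + (p - q)\<^sup>2 * (inverse a + inverse b) + 4 * (q + p)) / (8 * p)))"
      using nz unfolding a_def[symmetric] b_def[symmetric] p_def[symmetric]
      by (simp add: field_simps power2_eq_square)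
    show ?thesis
      unfolding curv_coeff_eq[of i] curv_coeff_eq[of "- i"] x' ric_term_def x_def[symmetric] eig_minus
      using alg unfolding a_def b_def p_def q_def by simp
  qed
qed

lemma conn_coeff_minus: "conn_coeff (- k) (- l) = conn_coeff k l"
proof -
  have "struct_const CARD('n) (- k) (- l) = struct_const CARD('n) k l"
    by (rule struct_const_cong) (simp add: cross2_def)
  moreover have "eig (- k - l) = eig (k + l)"
    using eig_minus[of "k + l"] by simp
  ultimately show ?thesis
    by (simp add: conn_coeff_def eig_minus)
qed

text \<open>The cross product is unchanged when both arguments are negated, and \<open>eig\<close>
  is even, so reversing all indices is a symmetry.\<close>

lemma curv_coeff_minus: "curv_coeff (- i) (- k) (- l) = curv_coeff i k l"
proof -
  have "struct_const CARD('n) (- i) (- k) = struct_const CARD('n) i k"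
    by (rule struct_const_cong) (simp add: cross2_def)
  then show ?thesis
    unfolding curv_coeff_def minus_add_distrib[symmetric] add_uminus_conv_diff[symmetric]
    using conn_coeff_minus[of i "k + l"] conn_coeff_minus[of k "i + l"] conn_coeff_minus[of "i + k" l]
    by (simp add: conn_coeff_minus)
qed

lemma sum_curv_coeff:
  "(\<Sum>i\<in>Z_N CARD('n). curv_coeff i k (- k)) = 2 * (\<Sum>i\<in>Z_N_plus CARD('n). ric_term k i)"
  unfolding sum_Z_N[OF odd_card] sum_distrib_left
  by (intro sum.cong refl curv_coeff_pair) (use Z_N_plus_subset in blast)

lemma ric_T_mat_minus: "ric (T_mat (- k)) (T_mat k) = ric (T_mat k) (T_mat (- k))"
proof -
  have "(\<Sum>i\<in>Z_N CARD('n). curv_coeff i (- k) k) = (\<Sum>i\<in>Z_N CARD('n). curv_coeff (- i) (- k) k)"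
    by (rule sum_Z_N_minus[OF odd_card, symmetric])
  moreover have "curv_coeff (- i) (- k) k = curv_coeff i k (- k)" for i
    using curv_coeff_minus[of i k "- k"] by simp
  ultimately show ?thesis
    using ric_T_mat[of "- k"] ric_T_mat[of k] by (simp only: minus_minus)
qed

text \<open>Both indices lie in the half system, so k + l is never in the zero class, and k - l is
  so only for k = l. Then just the two pairings of T_k with T_(-k) survive.\<close>

lemma ric_basis:
  assumes k: "k \<in> Z_N_plus CARD('n)" and E: "E \<in> {X_mat k, Y_mat k}"
    and l: "l \<in> Z_N_plus CARD('n)" and F: "F \<in> {X_mat l, Y_mat l}"
  shows "ric E F = of_real (if E = F then (\<Sum>i\<in>Z_N_plus CARD('n). ric_term k i) else 0)"
proof -
  have kZ: "k \<in> Z_N CARD('n)" and lZ: "l \<in> Z_N CARD('n)"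
    using k l Z_N_plus_subset by blast+
  have mkZ: "- k \<in> Z_N CARD('n)" and mlZ: "- l \<in> Z_N CARD('n)"
    using kZ lZ by (simp_all add: minus_in_Z_N[OF odd_card])
  have "- k \<noteq> l" "k \<noteq> - l"
    using Z_N_plus_not_minus[OF k] Z_N_plus_not_minus[OF l] k l by metis+
  then have plus: "\<not> null_mod CARD('n) (k + l)" "\<not> null_mod CARD('n) (- k - l)"
    using Z_N_unique[OF odd_card kZ mlZ] Z_N_unique[OF odd_card mkZ lZ] by auto
  show ?thesis
  proof (cases "k = l")
    case False
    then have minus: "\<not> null_mod CARD('n) (k - l)" "\<not> null_mod CARD('n) (l - k)"
      using Z_N_unique[OF odd_card kZ lZ] Z_N_unique[OF odd_card lZ kZ] by auto
    have "ric E F = 0"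
      using E F plus minus
      by (auto simp: X_mat_eq Y_mat_eq' ric_add ric_cscale ric_T_mat_0)
    \<comment> \<open>The case distinction compares matrices, not indices, so E and F must be told
      apart by a Fourier coefficient.\<close>
    moreover have "coeff_T k E \<noteq> 0" "coeff_T k F = 0"
      using E F coeff_T_X_mat[OF odd_card kZ] coeff_T_Y_mat[OF odd_card kZ] False \<open>k \<noteq> - l\<close>
      by (auto simp: X_mat_eq[of l] Y_mat_eq[of l] coeff_T_cscale coeff_T_add coeff_T_diff
          coeff_T_T_mat_Z_N[OF odd_card lZ kZ] coeff_T_T_mat_Z_N[OF odd_card mlZ kZ])
    then have "E \<noteq> F" by auto
    ultimately show ?thesis by simp
  next
    case True
    have XY: "X_mat k \<noteq> (Y_mat k :: 'n cmat)"
      using coeff_T_X_mat(1)[OF odd_card kZ] coeff_T_Y_mat(1)[OF odd_card kZ]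
      by (auto simp: complex_eq_iff)
    define S where "S = (\<Sum>i\<in>Z_N_plus CARD('n). ric_term k i)"
    have zero: "ric (T_mat k) (T_mat k) = 0" "ric (T_mat (- k)) (T_mat (- k)) = 0"
      using plus True by (simp_all add: ric_T_mat_0)
    \<comment> \<open>Equality of the two values cancels the mixed X, Y entries; in the diagonal
      ones two values 2 S meet the weight 1/4.\<close>
    have P: "ric (T_mat k) (T_mat (- k)) = of_real (2 * S)" "ric (T_mat (- k)) (T_mat k) = of_real (2 * S)"
      unfolding ric_T_mat_minus by (simp_all only: ric_T_mat sum_curv_coeff S_def)
    have "ric (X_mat k) (X_mat k) = of_real S"
      unfolding X_mat_eq ric_add ric_cscale zero P by simp
    moreover have "ric (Y_mat k) (Y_mat k) = of_real S"
      unfolding Y_mat_eq' ric_add ric_cscale zero P by (simp add: complex_eq_iff)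
    moreover have "ric (X_mat k) (Y_mat k) = 0" "ric (Y_mat k) (X_mat k) = 0"
      unfolding X_mat_eq Y_mat_eq' ric_add ric_cscale zero P by (simp_all add: complex_eq_iff)
    ultimately show ?thesis
      using E F True XY unfolding S_def by auto
  qed
qed

end

theorem theorem3p2:
  fixes L :: "'n::{finite,linorder} cmat \<Rightarrow> 'n cmat"
    and lam :: "int \<times> int \<Rightarrow> real"
    and nab :: "'n vfield \<Rightarrow> 'n vfield \<Rightarrow> 'n vfield"
    and N :: nat
    and k l :: "int \<times> int"
    and E F :: "'n cmat"
  assumes N: "N = CARD('n)" "odd N" "N \<ge> 3"
    and L: "zeitlin_operator L lam"
    and LC: "levi_civita (zeitlin_metric L) nab"
    and k: "k \<in> Z_N_plus N" and E: "E \<in> {X_mat k, Y_mat k}"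
    and l: "l \<in> Z_N_plus N" and F: "F \<in> {X_mat l, Y_mat l}"
  shows "Ric_N L nab E F =
    (if E = F then
       (\<Sum>i\<in>Z_N_plus N.
          (real N / pi * sin (pi / real N * real_of_int (cross2 k i)))\<^sup>2 / (real N ^ 2 - 1) *
          ((- 3 * (lam (red N (k + i)) + lam (red N (k - i)))
            + (lam i - lam k)\<^sup>2 * (inverse (lam (red N (k + i))) + inverse (lam (red N (k - i))))
            + 4 * (lam k + lam i)) / (8 * lam i)))
     else 0)"
proof -
  interpret zeitlin L lam
    using N L by unfold_locales auto
  have Z: "j \<in> Z_N CARD('n)" if "j \<in> Z_N_plus N" for j
    using that Z_N_plus_subset N by blast
  have su: "E \<in> su" "F \<in> su"
    using E F su_X_mat[OF odd_card Z[OF k]] su_Y_mat[OF odd_card Z[OF k]]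
      su_X_mat[OF odd_card Z[OF l]] su_Y_mat[OF odd_card Z[OF l]]
    by auto
  have "ric_term k i / (real N ^ 2 - 1) =
      (real N / pi * sin (pi / real N * real_of_int (cross2 k i)))\<^sup>2 / (real N ^ 2 - 1) *
      ((- 3 * (lam (red N (k + i)) + lam (red N (k - i)))
        + (lam i - lam k)\<^sup>2 * (inverse (lam (red N (k + i))) + inverse (lam (red N (k - i))))
        + 4 * (lam k + lam i)) / (8 * lam i))" if i: "i \<in> Z_N_plus N" for i
  \<comment> \<open>When the sine vanishes, an index k + i or k - i may lie in the zero class, where
    \<open>eig\<close> is 0 but \<open>lam\<close> at (0, 0) is arbitrary; both sides are then
    0.\<close>
  proof (cases "struct_const N k i = 0")
    case True
    then have "real N / pi * sin (pi / real N * real_of_int (cross2 k i)) = 0"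
      by (simp only: struct_const_def neg_equal_0_iff_equal)
    with True show ?thesis
      unfolding ric_term_def N(1)[symmetric] by simp
  next
    case False
    have nd: "\<not> int N dvd cross2 k i"
      using False struct_const_eq_0 N by blast
    have "eig (k + i) = lam (red N (k + i))" "eig (k - i) = lam (red N (k - i))"
      using not_null_mod_if_cross2[OF nd] N by (simp_all add: eig_def extend_mod_def)
    moreover have "eig i = lam i" "eig k = lam k"
      unfolding eig_def using Z[OF i] Z[OF k] extend_mod_Z_N[OF odd_card] by auto
    moreover have "(struct_const CARD('n) k i)\<^sup>2 =
        (real N / pi * sin (pi / real N * real_of_int (cross2 k i)))\<^sup>2"
      unfolding struct_const_def N(1)[symmetric] by (rule power2_minus)
    ultimately show ?thesis
      unfolding ric_term_def by simp
  qed
  then show ?thesis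
    using Ric_N_eq_ric[OF LC su] ric_basis[OF k[unfolded N] E l[unfolded N] F] N
    by (simp add: sum_divide_distrib)
qed

end
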